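(* Let $(\alpha,\beta)$ be a point with nonzero coordinates on the curve $Fer_4:\ 16X^4+16Y^4=X^4Y^4$ over a field of characteristic $0$. Then there is a cyclic isogeny $\phi_{\alpha,\beta}:E_1(\alpha)\to E_1(\beta)$ of degree $4$ (defined over an algebraic closure) whose kernel is $\ker(\phi_{\alpha,\beta})=\langle(0,0)\rangle$.
   Context: For $\alpha\neq0$, $E_1(\alpha)$ denotes the elliptic curve $Y^2+XY+\frac{1}{\alpha^4}Y=X^3+\frac{1}{\alpha^4}X^2$ (Tate normal form, on which $(0,0)$ is a point of order $4$). *)

theory Defs
  imports
    "HOL-Algebra.Elementary_Groups"
    "HOL-Algebra.QuotRing"
    "HOL-Algebra.Embedded_Algebras"
    "HOL-Algebra.Algebraic_Closure_Type"
begin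

section \<open>Weierstrass curves and their points\<close>

text \<open>
  \<open>Weierstrass a1 a2 a3 a4 a6\<close> stands for the projective plane curve with affine equation
  \<open>y\<^sup>2 + a1 x y + a3 y = x\<^sup>3 + a2 x\<^sup>2 + a4 x + a6\<close>; applying
  \<open>map_weierstrass\<close> to a field embedding is base change.
\<close>

datatype 'k weierstrass = Weierstrass 'k 'k 'k 'k 'k

datatype 'k point = Infinity | Affine 'k 'k

fun discriminant :: "'k::field weierstrass \<Rightarrow> 'k" where
  "discriminant (Weierstrass a1 a2 a3 a4 a6) =
     (let b2 = a1^2 + 4 * a2;
          b4 = 2 * a4 + a1 * a3;
          b6 = a3^2 + 4 * a6;
          b8 = a1^2 * a6 + 4 * a2 * a6 - a1 * a3 * a4 + a2 * a3^2 - a4^2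
      in - (b2^2 * b8) - 8 * b4^3 - 27 * b6^2 + 9 * b2 * b4 * b6)"

definition elliptic_curve :: "'k::field weierstrass \<Rightarrow> bool" where
  "elliptic_curve E \<longleftrightarrow> discriminant E \<noteq> 0"

fun on_curve :: "'k::field weierstrass \<Rightarrow> 'k point \<Rightarrow> bool" where
  "on_curve E Infinity \<longleftrightarrow> True"
| "on_curve (Weierstrass a1 a2 a3 a4 a6) (Affine x y) \<longleftrightarrow>
     y^2 + a1 * x * y + a3 * y = x^3 + a2 * x^2 + a4 * x + a6"

definition points :: "'k::field weierstrass \<Rightarrow> 'k point set" where
  "points E = {P. on_curve E P}"


section \<open>The chord-and-tangent group law\<close>

text \<open>
  In the last two cases \<open>l\<close> is the slope of the chord or tangent line, whose third
  intersection point with the curve is reflected by \<open>(x, y) \<mapsto> (x, - y - a1 x - a3)\<close>.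
\<close>

fun point_add :: "'k::field weierstrass \<Rightarrow> 'k point \<Rightarrow> 'k point \<Rightarrow> 'k point" where
  "point_add E Infinity Q = Q"
| "point_add E P Infinity = P"
| "point_add (Weierstrass a1 a2 a3 a4 a6) (Affine x1 y1) (Affine x2 y2) =
     (if x1 = x2 \<and> y1 + y2 + a1 * x2 + a3 = 0 then Infinity
      else
        let l = (if x1 = x2
                 then (3 * x1^2 + 2 * a2 * x1 + a4 - a1 * y1) / (2 * y1 + a1 * x1 + a3)
                 else (y2 - y1) / (x2 - x1));
            x3 = l^2 + a1 * l - a2 - x1 - x2
        in Affine x3 (- (y1 + l * (x3 - x1)) - a1 * x3 - a3))"

definition point_group :: "'k::field weierstrass \<Rightarrow> 'k point monoid" where
  "point_group E = \<lparr>carrier = points E, monoid.mult = point_add E, one = Infinity\<rparr>"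


section \<open>Morphisms and function fields\<close>

text \<open>
  From here on the ground field is algebraically closed, so that a curve may be identified
  with its set of points, and its nonempty open subsets are exactly the cofinite ones.
\<close>

fun homog_coords :: "'k::field point \<Rightarrow> 'k \<times> 'k \<times> 'k" where
  "homog_coords Infinity = (0, 1, 0)"
| "homog_coords (Affine x y) = (x, y, 1)"

text \<open>
  The value at a point of the form of degree \<open>d\<close> in three variables in which the monomial
  \<open>x\<^sup>i y\<^sup>j z\<^sup>d\<^sup>-\<^sup>i\<^sup>-\<^sup>j\<close> has coefficient \<open>c i j\<close>.
\<close>

definition form_at :: "nat \<Rightarrow> (nat \<Rightarrow> nat \<Rightarrow> 'k::field) \<Rightarrow> 'k point \<Rightarrow> 'k" where
  "form_at d c P =
     (case homog_coords P of (x, y, z) \<Rightarrow>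
        \<Sum>i\<le>d. \<Sum>j\<le>d - i. c i j * x ^ i * y ^ j * z ^ (d - i - j))"

definition proj_eq :: "'k::field \<times> 'k \<times> 'k \<Rightarrow> 'k \<times> 'k \<times> 'k \<Rightarrow> bool" where
  "proj_eq v w \<longleftrightarrow>
     (case v of (v1, v2, v3) \<Rightarrow> case w of (w1, w2, w3) \<Rightarrow>
        \<exists>l. l \<noteq> 0 \<and> v1 = l * w1 \<and> v2 = l * w2 \<and> v3 = l * w3)"

text \<open>
  A morphism is a map which around every point is given by three forms of equal degree
  without common zero there.
\<close>

definition curve_morphism ::
  "'k::alg_closed_field weierstrass \<Rightarrow> 'k weierstrass \<Rightarrow> ('k point \<Rightarrow> 'k point) \<Rightarrow> bool" where
  "curve_morphism E E' \<phi> \<longleftrightarrow>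
     \<phi> ` points E \<subseteq> points E' \<and>
     (\<forall>P\<in>points E. \<exists>d a b c.
        (form_at d a P, form_at d b P, form_at d c P) \<noteq> (0, 0, 0) \<and>
        (\<forall>Q\<in>points E.
           (form_at d a Q, form_at d b Q, form_at d c Q) \<noteq> (0, 0, 0) \<longrightarrow>
           proj_eq (form_at d a Q, form_at d b Q, form_at d c Q) (homog_coords (\<phi> Q))))"

text \<open>
  A rational function is an equivalence class of functions on the points which agree
  with a quotient of two forms of equal degree up to finitely many exceptions, two functions
  being equivalent if they differ at only finitely many points of the curve.
\<close>

definition rational_functions :: "'k::alg_closed_field weierstrass \<Rightarrow> ('k point \<Rightarrow> 'k) ring" where
  "rational_functions E =
     \<lparr>carrier = {f. \<exists>d a b. finite {P \<in> points E. form_at d b P = 0 \<or>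
                                      f P \<noteq> form_at d a P / form_at d b P}},
      monoid.mult = (\<lambda>f g P. f P * g P), one = (\<lambda>P. 1),
      ring.zero = (\<lambda>P. 0), add = (\<lambda>f g P. f P + g P)\<rparr>"

definition negligible_functions :: "'k::alg_closed_field weierstrass \<Rightarrow> ('k point \<Rightarrow> 'k) set" where
  "negligible_functions E =
     {f \<in> carrier (rational_functions E). finite {P \<in> points E. f P \<noteq> 0}}"

definition function_field :: "'k::alg_closed_field weierstrass \<Rightarrow> ('k point \<Rightarrow> 'k) set ring" where
  "function_field E = rational_functions E Quot negligible_functions E"

text \<open>
  Composition with a nonconstant morphism, whose fibres are finite, respects this
  equivalence, so that the union below is a single coset.
\<close>

definition pullback ::
  "'k::alg_closed_field weierstrass \<Rightarrow> ('k point \<Rightarrow> 'k point) \<Rightarrow>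
     ('k point \<Rightarrow> 'k) set \<Rightarrow> ('k point \<Rightarrow> 'k) set" where
  "pullback E \<phi> F = (\<Union>f\<in>F. negligible_functions E +>\<^bsub>rational_functions E\<^esub> (f \<circ> \<phi>))"

text \<open>The degree is \<open>[K(E) : \<phi>\<^sup>* K(E')]\<close>.\<close>

definition has_degree ::
  "'k::alg_closed_field weierstrass \<Rightarrow> 'k weierstrass \<Rightarrow> ('k point \<Rightarrow> 'k point) \<Rightarrow> nat \<Rightarrow> bool" where
  "has_degree E E' \<phi> n \<longleftrightarrow>
     ring.dimension (function_field E) n
       (pullback E \<phi> ` carrier (function_field E')) (carrier (function_field E))"


section \<open>Isogenies\<close>

definition isogeny ::
  "'k::alg_closed_field weierstrass \<Rightarrow> 'k weierstrass \<Rightarrow> ('k point \<Rightarrow> 'k point) \<Rightarrow> bool" where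
  "isogeny E E' \<phi> \<longleftrightarrow>
     elliptic_curve E \<and> elliptic_curve E' \<and> curve_morphism E E' \<phi> \<and>
     \<phi> Infinity = Infinity \<and> (\<exists>P\<in>points E. \<phi> P \<noteq> Infinity)"

definition isogeny_kernel ::
  "'k::alg_closed_field weierstrass \<Rightarrow> 'k weierstrass \<Rightarrow> ('k point \<Rightarrow> 'k point) \<Rightarrow> 'k point set" where
  "isogeny_kernel E E' \<phi> = kernel (point_group E) (point_group E') \<phi>"

definition cyclic_isogeny ::
  "'k::alg_closed_field weierstrass \<Rightarrow> 'k weierstrass \<Rightarrow> ('k point \<Rightarrow> 'k point) \<Rightarrow> bool" where
  "cyclic_isogeny E E' \<phi> \<longleftrightarrow>
     isogeny E E' \<phi> \<and>
     cyclic_group ((point_group E)\<lparr>carrier := isogeny_kernel E E' \<phi>\<rparr>)"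


section \<open>The Tate normal form and the Fermat-type quartic\<close>

definition E1 :: "'k::field \<Rightarrow> 'k weierstrass" where
  "E1 \<alpha> = Weierstrass 1 (1 / \<alpha>^4) (1 / \<alpha>^4) 0 0"

definition E1_closure :: "'k::field \<Rightarrow> 'k alg_closure weierstrass" where
  "E1_closure \<alpha> = map_weierstrass to_ac (E1 \<alpha>)"

definition Fer4 :: "('k::field \<times> 'k) set" where
  "Fer4 = {(x, y). 16 * x^4 + 16 * y^4 = x^4 * y^4}"

end

theory Submission
  imports Defs
begin

text \<open>
  Write \<open>t = 1/\<alpha>\<^sup>4\<close> and \<open>T = 1/\<beta>\<^sup>4\<close>; the Fermat equation becomes \<open>t + T = 1/16\<close>. The point
  \<open>(0, 0)\<close> has order 4 and its double is \<open>(-t, 0)\<close>. Completing the square and translating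
  \<open>(-t, 0)\<close> to the origin gives \<open>Y\<^sup>2 = X (X\<^sup>2 + (1/4 - 2t) X + t\<^sup>2)\<close>, and the classical 2-isogeny
  \<open>(X, Y) \<mapsto> (Y\<^sup>2/X\<^sup>2, Y (b - X\<^sup>2)/X\<^sup>2)\<close> of \<open>Y\<^sup>2 = X (X\<^sup>2 + a X + b)\<close> with kernel \<open>{O, (0, 0)}\<close> leads, after
  moving the image of \<open>(0, 0)\<close> to the origin, to \<open>y\<^sup>2 = x (x\<^sup>2 + (1/2 - 4T) x + t)\<close>. A second
  2-isogeny of this kind lands on a curve that is a twist of \<open>E\<^sub>1(\<beta>)\<close> by \<open>-1\<close>, hence isomorphic to
  it over the algebraic closure.

  For a 2-isogeny \<open>\<phi>\<close> the abscissa \<open>u\<close> satisfies a quadratic equation over the pulled back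
  function field, whose roots are the values of \<open>u\<close> at the two points of a fibre. Comparing these
  two points shows that \<open>1, u\<close> are independent, and that the norm of a nonzero function is
  nonzero, so that the combinations of \<open>1, u\<close> are closed under inverses and exhaust the function
  field. The products of two such bases form a basis of length 4 for the composition.
\<close>

subsection \<open>Forms and morphisms\<close>

text \<open>Why the second isogeny ends at E_1(beta): \<open>16 * t + 16 * T = 1\<close> gives A^2 -
  4t = 16 T^2 for A = 1/2 - 4T. So the classical codomain Y^2 = X (X^2 - 2 A X + A^2 - 4t) has
  constant term (4T)^2. Putting X = -4 S turns the right side into -64 S (S^2 + (1/4 - 2T) S + T^2),
  which up to the factor -64 is the completed square of the Tate form for T. This is the origin of
  the twist and of the square root \<open>k\<close> of -1/64. The obstacle in the degree computation
  is that functions are only known modulo finite sets of points. Every identity is therefore stated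
  at almost all points, and a rational function comes with a denominator that is nonzero off a
  finite set. The place of irreducibility of the curve is taken by a fibre argument: a finite bad
  set upstairs has a finite image, so over almost every point downstairs the whole fibre is good,
  and an identity may be evaluated at two of its points at once.\<close>

text \<open>A form is treated as a function rather than as a coefficient family, so that products
  and substitutions of forms can be written down directly and their degrees derived by
  rules.\<close>

definition is_form :: "nat \<Rightarrow> ('k::field \<Rightarrow> 'k \<Rightarrow> 'k \<Rightarrow> 'k) \<Rightarrow> bool" where
  "is_form d F \<longleftrightarrow>
     (\<exists>c. \<forall>x y z. F x y z = (\<Sum>i\<le>d. \<Sum>j\<le>d - i. c i j * x ^ i * y ^ j * z ^ (d - i - j)))"

definition form_val :: "('k::field \<Rightarrow> 'k \<Rightarrow> 'k \<Rightarrow> 'k) \<Rightarrow> 'k point \<Rightarrow> 'k" where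
  "form_val F P = (case homog_coords P of (x, y, z) \<Rightarrow> F x y z)"

lemma form_val_simps [simp]:
  "form_val F Infinity = F 0 1 0" "form_val F (Affine x y) = F x y 1"
  by (simp_all add: form_val_def)

lemma form_at_eq_form_val:
  "form_at d c = form_val (\<lambda>x y z. \<Sum>i\<le>d. \<Sum>j\<le>d - i. c i j * x ^ i * y ^ j * z ^ (d - i - j))"
  by (rule ext) (simp add: form_at_def form_val_def)

lemma is_form_sum_monomials:
  "is_form d (\<lambda>x y z. \<Sum>i\<le>d. \<Sum>j\<le>d - i. c i j * x ^ i * y ^ j * z ^ (d - i - j))"
  unfolding is_form_def by blast

lemma is_form_imp_form_at:
  assumes "is_form d F"
  obtains c where "form_at d c = form_val F"
proof -
  from assms obtain c where
    "\<And>x y z. F x y z = (\<Sum>i\<le>d. \<Sum>j\<le>d - i. c i j * x ^ i * y ^ j * z ^ (d - i - j))"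
    unfolding is_form_def by blast
  then have "F = (\<lambda>x y z. \<Sum>i\<le>d. \<Sum>j\<le>d - i. c i j * x ^ i * y ^ j * z ^ (d - i - j))"
    by (intro ext)
  then have "form_at d c = form_val F"
    by (simp only: form_at_eq_form_val)
  then show thesis by (rule that)
qed

text \<open>The predicate \<open>R\<close> is arbitrary, so coefficient families can be exchanged
  for forms under nested quantifiers, one variable at a time.\<close>

lemma ex_form_at_iff: "(\<exists>c. R (form_at d c)) \<longleftrightarrow> (\<exists>F. is_form d F \<and> R (form_val F))"
proof
  assume "\<exists>c. R (form_at d c)"
  then show "\<exists>F. is_form d F \<and> R (form_val F)"
    unfolding form_at_eq_form_val using is_form_sum_monomials by blast
next
  assume "\<exists>F. is_form d F \<and> R (form_val F)"
  then obtain F where F: "is_form d F" "R (form_val F)" by blast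
  from F(1) obtain c where "form_at d c = form_val F" by (rule is_form_imp_form_at)
  with F(2) show "\<exists>c. R (form_at d c)" by metis
qed

lemma is_form_zero: "is_form d (\<lambda>x y z. 0)"
  unfolding is_form_def by (rule exI[of _ "\<lambda>i j. 0"]) simp

lemma is_form_add:
  assumes "is_form d F" "is_form d G"
  shows "is_form d (\<lambda>x y z. F x y z + G x y z)"
proof -
  from assms(1) obtain c where
    "\<And>x y z. F x y z = (\<Sum>i\<le>d. \<Sum>j\<le>d - i. c i j * x ^ i * y ^ j * z ^ (d - i - j))"
    unfolding is_form_def by blast
  moreover from assms(2) obtain c' where
    "\<And>x y z. G x y z = (\<Sum>i\<le>d. \<Sum>j\<le>d - i. c' i j * x ^ i * y ^ j * z ^ (d - i - j))"
    unfolding is_form_def by blast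
  ultimately show ?thesis unfolding is_form_def
    by (intro exI[of _ "\<lambda>i j. c i j + c' i j"]) (simp only: sum.distrib distrib_right simp_thms)
qed

lemma is_form_sum:
  assumes "\<And>i. i \<in> A \<Longrightarrow> is_form d (F i)"
  shows "is_form d (\<lambda>x y z. \<Sum>i\<in>A. F i x y z)"
  using assms by (induction A rule: infinite_finite_induct) (auto intro: is_form_zero is_form_add)

lemma is_form_monomial:
  assumes "d = i0 + j0 + k0"
  shows "is_form d (\<lambda>x y z. a * x ^ i0 * y ^ j0 * z ^ k0)"
  unfolding is_form_def
proof (intro exI allI)
  fix x y z
  let ?c = "\<lambda>i j. if i = i0 \<and> j = j0 then a else 0"
  have "(\<Sum>i\<le>d. \<Sum>j\<le>d - i. ?c i j * x ^ i * y ^ j * z ^ (d - i - j)) =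
        (\<Sum>i\<le>d. if i = i0 then \<Sum>j\<le>d - i. if j = j0 then a * x ^ i0 * y ^ j0 * z ^ (d - i0 - j0) else 0 else 0)"
    by (intro sum.cong refl) (auto intro!: sum.neutral sum.cong simp del: sum.delta sum.delta')
  also have "\<dots> = a * x ^ i0 * y ^ j0 * z ^ k0"
    using assms by (simp add: sum.delta)
  finally show "a * x ^ i0 * y ^ j0 * z ^ k0 =
    (\<Sum>i\<le>d. \<Sum>j\<le>d - i. ?c i j * x ^ i * y ^ j * z ^ (d - i - j))" by simp
qed

lemma is_form_const: "is_form 0 (\<lambda>x y z. a)"
  and is_form_X: "is_form (Suc 0) (\<lambda>x y z. x)"
  and is_form_Y: "is_form (Suc 0) (\<lambda>x y z. y)"
  and is_form_Z: "is_form (Suc 0) (\<lambda>x y z. z)"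
  using is_form_monomial[of 0 0 0 0 a] is_form_monomial[of "Suc 0" 1 0 0 1]
    is_form_monomial[of "Suc 0" 0 1 0 1] is_form_monomial[of "Suc 0" 0 0 1 1]
  by simp_all

lemma is_form_mult:
  assumes "is_form d F" "is_form e G"
  shows "is_form (d + e) (\<lambda>x y z. F x y z * G x y z)"
proof -
  from assms(1) obtain c where c:
    "\<And>x y z. F x y z = (\<Sum>i\<le>d. \<Sum>j\<le>d - i. c i j * x ^ i * y ^ j * z ^ (d - i - j))"
    unfolding is_form_def by blast
  from assms(2) obtain c' where c':
    "\<And>x y z. G x y z = (\<Sum>i\<le>e. \<Sum>j\<le>e - i. c' i j * x ^ i * y ^ j * z ^ (e - i - j))"
    unfolding is_form_def by blast
  have "F x y z * G x y z = (\<Sum>i\<le>d. \<Sum>j\<le>d - i. \<Sum>k\<le>e. \<Sum>l\<le>e - k.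
     (c i j * c' k l) * x ^ (i + k) * y ^ (j + l) * z ^ ((d - i - j) + (e - k - l)))" for x y z
    unfolding c c' sum_distrib_right
    unfolding sum_distrib_left
    by (intro sum.cong refl) (simp only: power_add mult_ac)
  then have "(\<lambda>x y z. F x y z * G x y z) = (\<lambda>x y z. \<Sum>i\<le>d. \<Sum>j\<le>d - i. \<Sum>k\<le>e. \<Sum>l\<le>e - k.
     (c i j * c' k l) * x ^ (i + k) * y ^ (j + l) * z ^ ((d - i - j) + (e - k - l)))"
    by (intro ext)
  then show ?thesis
    by (simp only:) (intro is_form_sum is_form_monomial; auto)
qed

lemma is_form_power:
  assumes "is_form d F"
  shows "is_form (n * d) (\<lambda>x y z. F x y z ^ n)"
  using assms by (induction n) (auto intro: is_form_const is_form_mult)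

lemma is_form_cmult:
  assumes "is_form d F"
  shows "is_form d (\<lambda>x y z. a * F x y z)"
  using is_form_mult[OF is_form_const assms] by simp

lemma is_form_uminus:
  assumes "is_form d F"
  shows "is_form d (\<lambda>x y z. - F x y z)"
  using is_form_cmult[OF assms, of "-1"] by simp

lemma is_form_diff:
  assumes "is_form d F" "is_form d G"
  shows "is_form d (\<lambda>x y z. F x y z - G x y z)"
  using is_form_add[OF assms(1) is_form_uminus[OF assms(2)]] by simp

lemma is_form_homogeneous:
  assumes "is_form d F"
  shows "F (l * x) (l * y) (l * z) = l ^ d * F x y z"
proof -
  from assms obtain c where c:
    "\<And>x y z. F x y z = (\<Sum>i\<le>d. \<Sum>j\<le>d - i. c i j * x ^ i * y ^ j * z ^ (d - i - j))"
    unfolding is_form_def by blast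
  have "c i j * (l * x) ^ i * (l * y) ^ j * (l * z) ^ (d - i - j) =
        l ^ d * (c i j * x ^ i * y ^ j * z ^ (d - i - j))" if "i \<le> d" "j \<le> d - i" for i j
  proof -
    have "c i j * (l * x) ^ i * (l * y) ^ j * (l * z) ^ (d - i - j) =
        l ^ (i + j + (d - i - j)) * (c i j * x ^ i * y ^ j * z ^ (d - i - j))"
      by (simp only: power_mult_distrib power_add mult_ac)
    also have "i + j + (d - i - j) = d"
      using that by simp
    finally show ?thesis .
  qed
  then show ?thesis
    unfolding c sum_distrib_left by (intro sum.cong) auto
qed

text \<open>A monomial of degree \<open>e\<close> in three forms of degree \<open>d\<close> has
  degree (i + j + (e - i - j)) d = e d.\<close>

lemma is_form_compose:
  assumes "is_form e G" "is_form d A" "is_form d B" "is_form d C"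
  shows "is_form (e * d) (\<lambda>x y z. G (A x y z) (B x y z) (C x y z))"
proof -
  from assms obtain c where c:
    "\<And>x y z. G x y z = (\<Sum>i\<le>e. \<Sum>j\<le>e - i. c i j * x ^ i * y ^ j * z ^ (e - i - j))"
    unfolding is_form_def by blast
  have "is_form (e * d) (\<lambda>x y z. c i j * A x y z ^ i * B x y z ^ j * C x y z ^ (e - i - j))"
    if "i \<le> e" "j \<le> e - i" for i j
  proof -
    have "is_form (0 + i * d + j * d + (e - i - j) * d)
       (\<lambda>x y z. c i j * A x y z ^ i * B x y z ^ j * C x y z ^ (e - i - j))"
      by (intro is_form_mult is_form_const is_form_power assms)
    also have "0 + i * d + j * d + (e - i - j) * d = (i + j + (e - i - j)) * d"
      by (simp add: algebra_simps)
    also have "i + j + (e - i - j) = e"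
      using that by simp
    finally show ?thesis .
  qed
  then show ?thesis
    unfolding c by (intro is_form_sum) auto
qed

lemma curve_morphism_iff:
  "curve_morphism E E' \<phi> \<longleftrightarrow>
     \<phi> ` points E \<subseteq> points E' \<and>
     (\<forall>P\<in>points E. \<exists>d A B C. is_form d A \<and> is_form d B \<and> is_form d C \<and>
        (form_val A P, form_val B P, form_val C P) \<noteq> (0, 0, 0) \<and>
        (\<forall>Q\<in>points E. (form_val A Q, form_val B Q, form_val C Q) \<noteq> (0, 0, 0) \<longrightarrow>
           proj_eq (form_val A Q, form_val B Q, form_val C Q) (homog_coords (\<phi> Q))))"
proof -
  have ex3: "(\<exists>a b c. R (form_at d a) (form_at d b) (form_at d c)) \<longleftrightarrow>
        (\<exists>A B C. is_form d A \<and> is_form d B \<and> is_form d C \<and> R (form_val A) (form_val B) (form_val C))"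
    for d :: nat and R :: "('a point \<Rightarrow> 'a) \<Rightarrow> ('a point \<Rightarrow> 'a) \<Rightarrow> ('a point \<Rightarrow> 'a) \<Rightarrow> bool"
    unfolding ex_form_at_iff[of "\<lambda>h. R _ _ h"] ex_form_at_iff[of "\<lambda>g. \<exists>F. is_form d F \<and> R _ g (form_val F)"]
      ex_form_at_iff[of "\<lambda>f. \<exists>G. is_form d G \<and> (\<exists>F. is_form d F \<and> R f (form_val G) (form_val F))"]
    by blast
  show ?thesis
    unfolding curve_morphism_def
      ex3[where R = "\<lambda>f g h. (f P, g P, h P) \<noteq> (0, 0, 0) \<and>
        (\<forall>Q\<in>points E. (f Q, g Q, h Q) \<noteq> (0, 0, 0) \<longrightarrow> proj_eq (f Q, g Q, h Q) (homog_coords (\<phi> Q)))" for P] ..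
qed

lemma curve_morphismE:
  assumes "curve_morphism E E' \<phi>" "P \<in> points E"
  obtains d A B C where "is_form d A" "is_form d B" "is_form d C"
    "(form_val A P, form_val B P, form_val C P) \<noteq> (0, 0, 0)"
    "\<forall>Q\<in>points E. (form_val A Q, form_val B Q, form_val C Q) \<noteq> (0, 0, 0) \<longrightarrow>
       proj_eq (form_val A Q, form_val B Q, form_val C Q) (homog_coords (\<phi> Q))"
  using bspec[OF conjunct2[OF assms(1)[unfolded curve_morphism_iff]] assms(2)] that
  by (elim exE conjE)

lemma proj_eq_trans:
  assumes "proj_eq u v" "proj_eq v w"
  shows "proj_eq u w"
proof -
  obtain u1 u2 u3 v1 v2 v3 w1 w2 w3 where uvw: "u = (u1, u2, u3)" "v = (v1, v2, v3)" "w = (w1, w2, w3)"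
    by (metis prod.exhaust)
  from assms obtain l m where "l \<noteq> 0" "m \<noteq> 0" "u1 = l * v1" "u2 = l * v2" "u3 = l * v3"
    "v1 = m * w1" "v2 = m * w2" "v3 = m * w3"
    unfolding proj_eq_def uvw by auto
  then show ?thesis
    unfolding proj_eq_def uvw by (auto intro!: exI[of _ "l * m"])
qed

text \<open>Near P the composite is given by substituting the triple for \<open>\<phi>\<close> at P
  into the triple for \<open>\<psi>\<close> at \<open>\<phi> P\<close>. Homogeneity makes this
  independent of the representative of \<open>\<phi> Q\<close>.\<close>

lemma curve_morphism_compose:
  assumes \<phi>: "curve_morphism E E' \<phi>" and \<psi>: "curve_morphism E' E'' \<psi>"
  shows "curve_morphism E E'' (\<psi> \<circ> \<phi>)"
  unfolding curve_morphism_iff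
proof (intro conjI ballI)
  show "(\<psi> \<circ> \<phi>) ` points E \<subseteq> points E''"
    using assms unfolding curve_morphism_def by (auto simp: image_subset_iff)
next
  fix P assume P: "P \<in> points E"
  then have \<phi>P: "\<phi> P \<in> points E'" if "P \<in> points E" for P
    using \<phi> that unfolding curve_morphism_def by auto
  from \<phi> P obtain d A B C where 1: "is_form d A" "is_form d B" "is_form d C"
    "(form_val A P, form_val B P, form_val C P) \<noteq> (0, 0, 0)"
    "\<forall>Q\<in>points E. (form_val A Q, form_val B Q, form_val C Q) \<noteq> (0, 0, 0) \<longrightarrow>
        proj_eq (form_val A Q, form_val B Q, form_val C Q) (homog_coords (\<phi> Q))"
    by (rule curve_morphismE)
  from \<psi> \<phi>P[OF P] obtain e F G H where 2: "is_form e F" "is_form e G" "is_form e H"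
    "(form_val F (\<phi> P), form_val G (\<phi> P), form_val H (\<phi> P)) \<noteq> (0, 0, 0)"
    "\<forall>Q\<in>points E'. (form_val F Q, form_val G Q, form_val H Q) \<noteq> (0, 0, 0) \<longrightarrow>
        proj_eq (form_val F Q, form_val G Q, form_val H Q) (homog_coords (\<psi> Q))"
    by (rule curve_morphismE)
  define comp where "comp = (\<lambda>F x y z. F (A x y z) (B x y z) (C x y z) :: 'a)"
  have comp_val: "form_val (comp F) Q = F (form_val A Q) (form_val B Q) (form_val C Q)" for F Q
    by (cases Q) (simp_all add: comp_def)
  \<comment> \<open>The triple for \<open>\<phi>\<close> yields the normalised coordinates of
    \<open>\<phi> Q\<close> times some \<open>l\<close>, so every form of degree \<open>e\<close>
    changes by the same factor \<open>l ^ e\<close>.\<close>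
  have scale: "\<exists>l. l \<noteq> 0 \<and> (\<forall>F. is_form e F \<longrightarrow> form_val (comp F) Q = l * form_val F (\<phi> Q))"
    if Q: "Q \<in> points E" and nz: "(form_val A Q, form_val B Q, form_val C Q) \<noteq> (0, 0, 0)" for Q
  proof -
    obtain x y z where xyz: "homog_coords (\<phi> Q) = (x, y, z)"
      by (metis prod.exhaust)
    from 1(5)[rule_format, OF Q nz] obtain l where l: "l \<noteq> 0" "form_val A Q = l * x" "form_val B Q = l * y" "form_val C Q = l * z"
      unfolding proj_eq_def xyz by auto
    have "form_val (comp F) Q = l ^ e * form_val F (\<phi> Q)" if "is_form e F" for F
      unfolding comp_val l is_form_homogeneous[OF that] by (simp add: form_val_def xyz)
    with l(1) show ?thesis
      by (intro exI[of _ "l ^ e"]) auto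
  qed
  show "\<exists>d A B C. is_form d A \<and> is_form d B \<and> is_form d C \<and>
        (form_val A P, form_val B P, form_val C P) \<noteq> (0, 0, 0) \<and>
        (\<forall>Q\<in>points E. (form_val A Q, form_val B Q, form_val C Q) \<noteq> (0, 0, 0) \<longrightarrow>
           proj_eq (form_val A Q, form_val B Q, form_val C Q) (homog_coords ((\<psi> \<circ> \<phi>) Q)))"
  proof (intro exI conjI ballI impI)
    show "is_form (e * d) (comp F)" "is_form (e * d) (comp G)" "is_form (e * d) (comp H)"
      unfolding comp_def by (intro is_form_compose 1 2)+
    show "(form_val (comp F) P, form_val (comp G) P, form_val (comp H) P) \<noteq> (0, 0, 0)"
      using scale[OF P 1(4)] 2 by auto
    fix Q assume Q: "Q \<in> points E"
      and nz: "(form_val (comp F) Q, form_val (comp G) Q, form_val (comp H) Q) \<noteq> (0, 0, 0)"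
    have "\<exists>l. l \<noteq> 0 \<and> (\<forall>F. is_form e F \<longrightarrow> form_val (comp F) Q = l * form_val F (\<phi> Q))"
    proof (cases "(form_val A Q, form_val B Q, form_val C Q) = (0, 0, 0)")
      case True
      \<comment> \<open>The inner triple may vanish at Q although the substituted one does not.
        Forms of positive degree vanish at the origin, so this happens only for constant forms,
        where the factor is 1.\<close>
      have e: "e = 0"
      proof (rule ccontr)
        assume "e \<noteq> 0"
        then have "K 0 0 0 = 0" if "is_form e K" for K :: "'a \<Rightarrow> 'a \<Rightarrow> 'a \<Rightarrow> 'a"
          using is_form_homogeneous[OF that, of 0 0 0 0] by (simp add: power_0_left)
        with nz 2 True show False by (simp add: comp_val)
      qed
      have "K x y z = K x' y' z'" if "is_form e K" for K :: "'a \<Rightarrow> 'a \<Rightarrow> 'a \<Rightarrow> 'a" and x y z x' y' z'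
        using is_form_homogeneous[OF that, of 0 x y z] is_form_homogeneous[OF that, of 0 x' y' z'] e by simp
      then show ?thesis
        by (intro exI[of _ 1]) (auto simp: comp_def form_val_def split: prod.splits)
    next
      case False
      then show ?thesis by (rule scale[OF Q])
    qed
    then obtain l where l: "l \<noteq> 0" "\<And>F. is_form e F \<Longrightarrow> form_val (comp F) Q = l * form_val F (\<phi> Q)"
      by blast
    then have "proj_eq (form_val (comp F) Q, form_val (comp G) Q, form_val (comp H) Q)
       (form_val F (\<phi> Q), form_val G (\<phi> Q), form_val H (\<phi> Q))"
      using 2 unfolding proj_eq_def by auto
    moreover have "proj_eq (form_val F (\<phi> Q), form_val G (\<phi> Q), form_val H (\<phi> Q)) (homog_coords (\<psi> (\<phi> Q)))"
      using nz l 2 by (intro 2(5)[rule_format] \<phi>P Q) auto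
    ultimately show "proj_eq (form_val (comp F) Q, form_val (comp G) Q, form_val (comp H) Q) (homog_coords ((\<psi> \<circ> \<phi>) Q))"
      by (auto dest: proj_eq_trans)
  qed
qed

section \<open>Rational functions, modulo finite sets of points\<close>

text \<open>The filter of cofinite subsets of the curve. Finite exceptional sets are then combined
  by \<open>eventually_elim\<close>, and pulling back along a map with finite fibres becomes a
  \<open>filterlim\<close> statement.\<close>

definition almost_all_points :: "'k::field weierstrass \<Rightarrow> 'k point filter" where
  "almost_all_points E = inf cofinite (principal (points E))"

lemma eventually_almost_all_points:
  "eventually p (almost_all_points E) \<longleftrightarrow> finite {P \<in> points E. \<not> p P}"
proof -
  have "{x. \<not> (x \<in> points E \<longrightarrow> p x)} = {P \<in> points E. \<not> p P}" by auto
  then show ?thesis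
    by (simp add: almost_all_points_def eventually_inf_principal eventually_cofinite)
qed

lemma eventually_affine: "eventually (\<lambda>P. P \<noteq> Infinity) (almost_all_points E)"
  unfolding eventually_almost_all_points by (rule finite_subset[of _ "{Infinity}"]) auto

abbreviation rational_fun :: "'k::alg_closed_field weierstrass \<Rightarrow> ('k point \<Rightarrow> 'k) \<Rightarrow> bool" where
  "rational_fun E f \<equiv> f \<in> carrier (rational_functions E)"

lemma rational_fun_iff:
  "rational_fun E f \<longleftrightarrow> (\<exists>d F G. is_form d F \<and> is_form d G \<and>
     eventually (\<lambda>P. form_val G P \<noteq> 0 \<and> f P = form_val F P / form_val G P) (almost_all_points E))"
proof -
  have ex2: "(\<exists>a b. R (form_at d a) (form_at d b)) \<longleftrightarrow>
        (\<exists>A B. is_form d A \<and> is_form d B \<and> R (form_val A) (form_val B))"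
    for d :: nat and R :: "('a point \<Rightarrow> 'a) \<Rightarrow> ('a point \<Rightarrow> 'a) \<Rightarrow> bool"
    unfolding ex_form_at_iff[of "\<lambda>g. R _ g"] ex_form_at_iff[of "\<lambda>f. \<exists>F. is_form d F \<and> R f (form_val F)"]
    by blast
  show ?thesis
    using ex2[where R = "\<lambda>g h. finite {P \<in> points E. h P = 0 \<or> f P \<noteq> g P / h P}"]
    by (simp add: rational_functions_def eventually_almost_all_points de_Morgan_conj)
qed

lemma rational_funE:
  assumes "rational_fun E f"
  obtains d F G where "is_form d F" "is_form d G"
    "eventually (\<lambda>P. form_val G P \<noteq> 0 \<and> f P = form_val F P / form_val G P) (almost_all_points E)"
  using assms unfolding rational_fun_iff by blast

lemma rational_fun_cong:
  assumes "rational_fun E f" "eventually (\<lambda>P. f P = g P) (almost_all_points E)"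
  shows "rational_fun E g"
proof -
  from assms(1) obtain d F G where fg: "is_form d F" "is_form d G"
    "eventually (\<lambda>P. form_val G P \<noteq> 0 \<and> f P = form_val F P / form_val G P) (almost_all_points E)"
    by (rule rational_funE)
  from fg(3) assms(2) have "eventually (\<lambda>P. form_val G P \<noteq> 0 \<and> g P = form_val F P / form_val G P) (almost_all_points E)"
    by eventually_elim auto
  with fg show ?thesis unfolding rational_fun_iff by blast
qed

lemma rational_fun_const: "rational_fun E (\<lambda>P. a)"
  unfolding rational_fun_iff
  by (rule exI[of _ 0], rule exI[of _ "\<lambda>x y z. a"], rule exI[of _ "\<lambda>x y z. 1"])
     (auto intro: is_form_const simp: form_val_def split: prod.splits)

lemma form_val_mult: "form_val (\<lambda>x y z. F x y z * G x y z) P = form_val F P * form_val G P"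
  and form_val_add: "form_val (\<lambda>x y z. F x y z + G x y z) P = form_val F P + form_val G P"
  by (simp_all add: form_val_def split: prod.splits)

lemma rational_fun_mult:
  assumes "rational_fun E f" "rational_fun E g"
  shows "rational_fun E (\<lambda>P. f P * g P)"
proof -
  from assms(1) obtain d F G where fg: "is_form d F" "is_form d G"
    "eventually (\<lambda>P. form_val G P \<noteq> 0 \<and> f P = form_val F P / form_val G P) (almost_all_points E)"
    by (rule rational_funE)
  from assms(2) obtain e H K where hk: "is_form e H" "is_form e K"
    "eventually (\<lambda>P. form_val K P \<noteq> 0 \<and> g P = form_val H P / form_val K P) (almost_all_points E)"
    by (rule rational_funE)
  have "eventually (\<lambda>P. form_val (\<lambda>x y z. G x y z * K x y z) P \<noteq> 0 \<and>
     f P * g P = form_val (\<lambda>x y z. F x y z * H x y z) P / form_val (\<lambda>x y z. G x y z * K x y z) P) (almost_all_points E)"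
    using fg(3) hk(3) by eventually_elim (simp add: form_val_mult)
  with is_form_mult[OF fg(1) hk(1)] is_form_mult[OF fg(2) hk(2)] show ?thesis
    unfolding rational_fun_iff by blast
qed

lemma rational_fun_add:
  assumes "rational_fun E f" "rational_fun E g"
  shows "rational_fun E (\<lambda>P. f P + g P)"
proof -
  from assms(1) obtain d F G where fg: "is_form d F" "is_form d G"
    "eventually (\<lambda>P. form_val G P \<noteq> 0 \<and> f P = form_val F P / form_val G P) (almost_all_points E)"
    by (rule rational_funE)
  from assms(2) obtain e H K where hk: "is_form e H" "is_form e K"
    "eventually (\<lambda>P. form_val K P \<noteq> 0 \<and> g P = form_val H P / form_val K P) (almost_all_points E)"
    by (rule rational_funE)
  have "eventually (\<lambda>P. form_val (\<lambda>x y z. G x y z * K x y z) P \<noteq> 0 \<and>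
     f P + g P = form_val (\<lambda>x y z. F x y z * K x y z + G x y z * H x y z) P / form_val (\<lambda>x y z. G x y z * K x y z) P) (almost_all_points E)"
    using fg(3) hk(3) by eventually_elim (simp add: form_val_mult form_val_add field_simps)
  with is_form_add[OF is_form_mult[OF fg(1) hk(2)] is_form_mult[OF fg(2) hk(1)]] is_form_mult[OF fg(2) hk(2)]
  show ?thesis
    unfolding rational_fun_iff by blast
qed

lemma rational_fun_inverse:
  assumes "rational_fun E f" "eventually (\<lambda>P. f P \<noteq> 0) (almost_all_points E)"
  shows "rational_fun E (\<lambda>P. inverse (f P))"
proof -
  from assms(1) obtain d F G where fg: "is_form d F" "is_form d G"
    "eventually (\<lambda>P. form_val G P \<noteq> 0 \<and> f P = form_val F P / form_val G P) (almost_all_points E)"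
    by (rule rational_funE)
  have "eventually (\<lambda>P. form_val F P \<noteq> 0 \<and> inverse (f P) = form_val G P / form_val F P) (almost_all_points E)"
    using fg(3) assms(2) by eventually_elim auto
  with fg show ?thesis
    unfolding rational_fun_iff by blast
qed

lemma rational_fun_uminus: "rational_fun E f \<Longrightarrow> rational_fun E (\<lambda>P. - f P)"
  using rational_fun_mult[OF rational_fun_const[of "-1" E], of f] by simp

lemma rational_fun_diff: "rational_fun E f \<Longrightarrow> rational_fun E g \<Longrightarrow> rational_fun E (\<lambda>P. f P - g P)"
  using rational_fun_add[of f E, OF _ rational_fun_uminus[of g E]] by simp

lemma rational_fun_divide:
  "rational_fun E f \<Longrightarrow> rational_fun E g \<Longrightarrow> eventually (\<lambda>P. g P \<noteq> 0) (almost_all_points E) \<Longrightarrow>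
     rational_fun E (\<lambda>P. f P / g P)"
  using rational_fun_mult[of f E, OF _ rational_fun_inverse[of g E]] by (simp add: divide_inverse)

lemma rational_fun_power: "rational_fun E f \<Longrightarrow> rational_fun E (\<lambda>P. f P ^ n)"
  by (induction n) (auto intro: rational_fun_const rational_fun_mult)

lemma rational_fun_sum:
  "(\<And>i. i \<in> A \<Longrightarrow> rational_fun E (f i)) \<Longrightarrow> rational_fun E (\<lambda>P. \<Sum>i\<in>A. f i P)"
  by (induction A rule: infinite_finite_induct) (auto intro: rational_fun_const rational_fun_add)

text \<open>Since functions are compared only off finite sets, these total functions can stand for
  the affine coordinates x/z and y/z.\<close>

fun x_coord :: "'k::field point \<Rightarrow> 'k" where
  "x_coord Infinity = 0" | "x_coord (Affine x y) = x"

fun y_coord :: "'k::field point \<Rightarrow> 'k" where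
  "y_coord Infinity = 0" | "y_coord (Affine x y) = y"

lemma rational_fun_x_coord: "rational_fun E x_coord"
proof -
  have "eventually (\<lambda>P. form_val (\<lambda>x y z. z) P \<noteq> 0 \<and>
      x_coord P = form_val (\<lambda>x y z. x) P / form_val (\<lambda>x y z. z) P) (almost_all_points E)"
    using eventually_affine
  proof eventually_elim
    case (elim P) then show ?case by (cases P) auto
  qed
  then show ?thesis
    unfolding rational_fun_iff using is_form_X is_form_Z by blast
qed

lemma rational_fun_y_coord: "rational_fun E y_coord"
proof -
  have "eventually (\<lambda>P. form_val (\<lambda>x y z. z) P \<noteq> 0 \<and>
      y_coord P = form_val (\<lambda>x y z. y) P / form_val (\<lambda>x y z. z) P) (almost_all_points E)"
    using eventually_affine
  proof eventually_elim
    case (elim P) then show ?case by (cases P) auto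
  qed
  then show ?thesis
    unfolding rational_fun_iff using is_form_Y is_form_Z by blast
qed

text \<open>Dehomogenisation: off \<open>Infinity\<close> a form is a polynomial in the two
  coordinates. Any class of functions closed under ring operations and inverses thus has to be
  tested on the coordinates only.\<close>

lemma form_at_affine:
  assumes "P \<noteq> Infinity"
  shows "form_at d c P = (\<Sum>i\<le>d. \<Sum>j\<le>d - i. c i j * x_coord P ^ i * y_coord P ^ j)"
  using assms by (cases P) (simp_all add: form_at_def)

subsection \<open>The function field and the degree\<close>

lemma rational_functions_sel:
  "f \<otimes>\<^bsub>rational_functions E\<^esub> g = (\<lambda>P. f P * g P)"
  "\<one>\<^bsub>rational_functions E\<^esub> = (\<lambda>P. 1)"
  "\<zero>\<^bsub>rational_functions E\<^esub> = (\<lambda>P. 0)"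
  "f \<oplus>\<^bsub>rational_functions E\<^esub> g = (\<lambda>P. f P + g P)"
  by (simp_all add: rational_functions_def)

lemma ring_rational_functions: "ring (rational_functions E)"
proof (rule ringI)
  show "abelian_group (rational_functions E)"
  proof (rule abelian_groupI)
    fix f assume f: "rational_fun E f"
    show "\<exists>g\<in>carrier (rational_functions E). g \<oplus>\<^bsub>rational_functions E\<^esub> f = \<zero>\<^bsub>rational_functions E\<^esub>"
      by (rule bexI[OF _ rational_fun_uminus[OF f]]) (simp add: rational_functions_sel)
  qed (auto simp: rational_functions_sel rational_fun_add rational_fun_const add_ac)
  show "Group.monoid (rational_functions E)"
    by (rule monoidI) (auto simp: rational_functions_sel rational_fun_mult rational_fun_const mult_ac)
qed (auto simp: rational_functions_sel algebra_simps)

lemma negligible_iff: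
  "f \<in> negligible_functions E \<longleftrightarrow> eventually (\<lambda>P. f P = 0) (almost_all_points E)"
proof
  assume *: "eventually (\<lambda>P. f P = 0) (almost_all_points E)"
  then have "eventually (\<lambda>P. 0 = f P) (almost_all_points E)"
    by eventually_elim simp
  from rational_fun_cong[OF rational_fun_const this] *
  show "f \<in> negligible_functions E"
    by (simp add: negligible_functions_def eventually_almost_all_points)
qed (simp add: negligible_functions_def eventually_almost_all_points)

lemma negligible_rational: "f \<in> negligible_functions E \<Longrightarrow> rational_fun E f"
  by (simp add: negligible_functions_def)

lemma ideal_negligible_functions: "ideal (negligible_functions E) (rational_functions E)"
proof (rule idealI)
  show "ring (rational_functions E)" by (rule ring_rational_functions)
  interpret ring "rational_functions E" by (rule ring_rational_functions)
  show "subgroup (negligible_functions E) (add_monoid (rational_functions E))"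
  proof (rule subgroup.intro)
    fix f assume f: "f \<in> negligible_functions E"
    then have "\<ominus>\<^bsub>rational_functions E\<^esub> f = (\<lambda>P. - f P)"
      by (intro minus_equality) (auto simp: rational_functions_sel negligible_rational rational_fun_uminus)
    with f show "inv\<^bsub>add_monoid (rational_functions E)\<^esub> f \<in> negligible_functions E"
      unfolding a_inv_def[symmetric] by (simp add: negligible_iff)
  next
    fix f g assume "f \<in> negligible_functions E" "g \<in> negligible_functions E"
    then have "eventually (\<lambda>P. f P = 0) (almost_all_points E)" "eventually (\<lambda>P. g P = 0) (almost_all_points E)"
      by (simp_all add: negligible_iff)
    then have "eventually (\<lambda>P. f P + g P = 0) (almost_all_points E)"
      by eventually_elim simp
    then show "f \<otimes>\<^bsub>add_monoid (rational_functions E)\<^esub> g \<in> negligible_functions E"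
      by (simp add: rational_functions_sel negligible_iff)
  qed (auto simp: negligible_rational negligible_iff rational_functions_sel)
next
  fix f g assume f: "f \<in> negligible_functions E" and "rational_fun E g"
  from f show "f \<otimes>\<^bsub>rational_functions E\<^esub> g \<in> negligible_functions E"
    "g \<otimes>\<^bsub>rational_functions E\<^esub> f \<in> negligible_functions E"
    by (auto simp: rational_functions_sel negligible_iff elim: eventually_mono)
qed

text \<open>The coset of \<open>f\<close> modulo the negligible functions, expressed by the filter
  alone so that equality of cosets becomes equality almost everywhere.\<close>

definition fun_class :: "'k::alg_closed_field weierstrass \<Rightarrow> ('k point \<Rightarrow> 'k) \<Rightarrow> ('k point \<Rightarrow> 'k) set" where
  "fun_class E f = {g. eventually (\<lambda>P. g P = f P) (almost_all_points E)}"

lemma coset_eq_fun_class: "negligible_functions E +>\<^bsub>rational_functions E\<^esub> f = fun_class E f"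
proof (intro equalityI subsetI)
  fix g assume "g \<in> fun_class E f"
  then have "eventually (\<lambda>P. g P - f P = 0) (almost_all_points E)"
    by (simp add: fun_class_def)
  then have "(\<lambda>P. g P - f P) \<in> negligible_functions E"
    by (simp add: negligible_iff)
  moreover have "g = (\<lambda>P. (g P - f P) + f P)"
    by simp
  ultimately show "g \<in> negligible_functions E +>\<^bsub>rational_functions E\<^esub> f"
    unfolding a_r_coset_def' rational_functions_sel by blast
next
  fix g assume "g \<in> negligible_functions E +>\<^bsub>rational_functions E\<^esub> f"
  then obtain h where "h \<in> negligible_functions E" "g = (\<lambda>P. h P + f P)"
    unfolding a_r_coset_def' rational_functions_sel by blast
  then show "g \<in> fun_class E f"
    by (auto simp: fun_class_def negligible_iff elim: eventually_mono)
qed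

lemma fun_class_eq_iff:
  "fun_class E f = fun_class E g \<longleftrightarrow> eventually (\<lambda>P. f P = g P) (almost_all_points E)"
proof
  assume "fun_class E f = fun_class E g"
  then have "f \<in> fun_class E g" by (auto simp: fun_class_def)
  then show "eventually (\<lambda>P. f P = g P) (almost_all_points E)" by (simp add: fun_class_def)
next
  assume *: "eventually (\<lambda>P. f P = g P) (almost_all_points E)"
  have "eventually (\<lambda>P. h P = f P) (almost_all_points E) \<longleftrightarrow> eventually (\<lambda>P. h P = g P) (almost_all_points E)" for h
    by (rule eventually_cong[OF *]) simp
  then show "fun_class E f = fun_class E g" by (simp add: fun_class_def)
qed

lemma carrier_function_field: "carrier (function_field E) = fun_class E ` carrier (rational_functions E)"
  unfolding function_field_def FactRing_def A_RCOSETS_def' by (auto simp: coset_eq_fun_class)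

lemma ring_function_field: "ring (function_field E)"
  unfolding function_field_def by (rule ideal.quotient_is_ring[OF ideal_negligible_functions])

lemma fun_class_mult:
  assumes "rational_fun E f" "rational_fun E g"
  shows "fun_class E f \<otimes>\<^bsub>function_field E\<^esub> fun_class E g = fun_class E (\<lambda>P. f P * g P)"
  using ring_hom_mult[OF ideal.rcos_ring_hom[OF ideal_negligible_functions] assms]
  by (simp add: coset_eq_fun_class function_field_def rational_functions_sel)

lemma fun_class_add:
  assumes "rational_fun E f" "rational_fun E g"
  shows "fun_class E f \<oplus>\<^bsub>function_field E\<^esub> fun_class E g = fun_class E (\<lambda>P. f P + g P)"
  using ring_hom_add[OF ideal.rcos_ring_hom[OF ideal_negligible_functions] assms]
  by (simp add: coset_eq_fun_class function_field_def rational_functions_sel)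

lemma zero_function_field: "\<zero>\<^bsub>function_field E\<^esub> = fun_class E (\<lambda>P. 0)"
proof -
  have "\<zero>\<^bsub>function_field E\<^esub> = negligible_functions E"
    by (simp add: function_field_def FactRing_def)
  also have "\<dots> = fun_class E (\<lambda>P. 0)"
    by (auto simp: fun_class_def negligible_iff)
  finally show ?thesis .
qed

text \<open>The preimage of a finite exceptional set is a finite union of finite fibres.\<close>

lemma filterlim_almost_all_points:
  assumes "\<phi> ` points E \<subseteq> points E'" "\<And>P. P \<in> points E' \<Longrightarrow> finite {Q \<in> points E. \<phi> Q = P}"
  shows "filterlim \<phi> (almost_all_points E') (almost_all_points E)"
  unfolding filterlim_iff
proof (intro allI impI)
  fix p assume "eventually p (almost_all_points E')"
  then have "finite {P \<in> points E'. \<not> p P}" by (simp add: eventually_almost_all_points)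
  then have "finite (\<Union>P\<in>{P \<in> points E'. \<not> p P}. {Q \<in> points E. \<phi> Q = P})"
    using assms(2) by blast
  moreover have "{Q \<in> points E. \<not> p (\<phi> Q)} \<subseteq> (\<Union>P\<in>{P \<in> points E'. \<not> p P}. {Q \<in> points E. \<phi> Q = P})"
    using assms(1) by auto
  ultimately show "eventually (\<lambda>Q. p (\<phi> Q)) (almost_all_points E)"
    unfolding eventually_almost_all_points by (rule finite_subset[rotated])
qed

text \<open>Representatives of one class agree almost everywhere, and by the limit assumption so do
  their composites with \<open>\<phi>\<close>. The union in \<open>pullback\<close> therefore
  consists of a single coset repeated.\<close>

lemma pullback_fun_class:
  assumes "filterlim \<phi> (almost_all_points E') (almost_all_points E)"
  shows "pullback E \<phi> (fun_class E' g) = fun_class E (g \<circ> \<phi>)"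
proof -
  have "fun_class E (f \<circ> \<phi>) = fun_class E (g \<circ> \<phi>)" if "f \<in> fun_class E' g" for f
    using that eventually_compose_filterlim[OF _ assms, of "\<lambda>P. f P = g P"]
    by (simp add: fun_class_eq_iff) (simp add: fun_class_def)
  moreover have "g \<in> fun_class E' g" by (simp add: fun_class_def)
  ultimately show ?thesis
    unfolding pullback_def coset_eq_fun_class by blast
qed

section \<open>Bases over the pulled back function field\<close>

text \<open>The recursion copies the inductive definition of \<open>ring.dimension\<close>: the
  empty list gives the zero space, and each further element is a line extension by a vector outside
  the span of the later ones, as recorded by \<open>pullback_independent\<close>. Working with
  functions instead of cosets keeps the computations pointwise.\<close>

fun pullback_span :: "'k::alg_closed_field weierstrass \<Rightarrow> 'k weierstrass \<Rightarrow> ('k point \<Rightarrow> 'k point) \<Rightarrow>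
    ('k point \<Rightarrow> 'k) list \<Rightarrow> ('k point \<Rightarrow> 'k) set" where
  "pullback_span E E' \<phi> [] = {f. eventually (\<lambda>P. f P = 0) (almost_all_points E)}"
| "pullback_span E E' \<phi> (u # us) = {f. \<exists>g. rational_fun E' g \<and> (\<exists>h\<in>pullback_span E E' \<phi> us.
     eventually (\<lambda>P. f P = g (\<phi> P) * u P + h P) (almost_all_points E))}"

fun pullback_independent :: "'k::alg_closed_field weierstrass \<Rightarrow> 'k weierstrass \<Rightarrow> ('k point \<Rightarrow> 'k point) \<Rightarrow>
    ('k point \<Rightarrow> 'k) list \<Rightarrow> bool" where
  "pullback_independent E E' \<phi> [] \<longleftrightarrow> True"
| "pullback_independent E E' \<phi> (u # us) \<longleftrightarrow>
     u \<notin> pullback_span E E' \<phi> us \<and> pullback_independent E E' \<phi> us"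

lemma pullback_span_cong:
  assumes "f \<in> pullback_span E E' \<phi> us" "eventually (\<lambda>P. f P = f' P) (almost_all_points E)"
  shows "f' \<in> pullback_span E E' \<phi> us"
proof (cases us)
  case Nil
  from assms(1) Nil have "eventually (\<lambda>P. f P = 0) (almost_all_points E)" by simp
  with assms(2) have "eventually (\<lambda>P. f' P = 0) (almost_all_points E)"
    by eventually_elim simp
  with Nil show ?thesis by simp
next
  case (Cons u vs)
  with assms(1) obtain g h where gh: "rational_fun E' g" "h \<in> pullback_span E E' \<phi> vs"
    "eventually (\<lambda>P. f P = g (\<phi> P) * u P + h P) (almost_all_points E)" by auto
  from gh(3) assms(2) have "eventually (\<lambda>P. f' P = g (\<phi> P) * u P + h P) (almost_all_points E)"
    by eventually_elim simp
  with gh Cons show ?thesis by auto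
qed

context
  fixes E E' :: "'k::alg_closed_field weierstrass" and \<phi> :: "'k point \<Rightarrow> 'k point"
  assumes fin: "filterlim \<phi> (almost_all_points E') (almost_all_points E)"
    and pull: "\<And>g. rational_fun E' g \<Longrightarrow> rational_fun E (\<lambda>P. g (\<phi> P))"
begin

lemma pullback_span_rational:
  "f \<in> pullback_span E E' \<phi> us \<Longrightarrow> (\<And>u. u \<in> set us \<Longrightarrow> rational_fun E u) \<Longrightarrow> rational_fun E f"
proof (induction us arbitrary: f)
  case Nil
  then show ?case using negligible_rational negligible_iff by auto
next
  case (Cons u us)
  then obtain g h where gh: "rational_fun E' g" "h \<in> pullback_span E E' \<phi> us"
    "eventually (\<lambda>P. f P = g (\<phi> P) * u P + h P) (almost_all_points E)" by auto
  have "rational_fun E (\<lambda>P. g (\<phi> P) * u P + h P)"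
    by (rule rational_fun_add[OF rational_fun_mult[OF pull[OF gh(1)]] Cons.IH[OF gh(2)]])
       (use Cons.prems in auto)
  then show ?case
    by (rule rational_fun_cong) (use gh(3) in eventually_elim, simp)
qed

text \<open>Induction on the list: passing to cosets turns the recursive clause of
  \<open>pullback_span\<close> into \<open>line_extension\<close>, and independence supplies the
  side condition of the successor rule for dimensions.\<close>

lemma dimension_pullback_span:
  assumes "\<And>u. u \<in> set us \<Longrightarrow> rational_fun E u" "pullback_independent E E' \<phi> us"
  shows "ring.dimension (function_field E) (length us)
    (pullback E \<phi> ` carrier (function_field E')) (fun_class E ` pullback_span E E' \<phi> us)"
  using assms
proof (induction us)
  case Nil
  have "fun_class E f = fun_class E (\<lambda>P. 0)" if "f \<in> pullback_span E E' \<phi> []" for f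
    using that by (simp add: fun_class_eq_iff)
  moreover have "(\<lambda>P. 0) \<in> pullback_span E E' \<phi> []"
    by simp
  ultimately have "fun_class E ` pullback_span E E' \<phi> [] = {\<zero>\<^bsub>function_field E\<^esub>}"
    unfolding zero_function_field by blast
  then show ?case
    using ring.zero_dim[OF ring_function_field] by simp
next
  case (Cons u us)
  let ?K = "pullback E \<phi> ` carrier (function_field E')"
  let ?S = "pullback_span E E' \<phi>"
  interpret F: ring "function_field E" by (rule ring_function_field)
  have K: "?K = (\<lambda>g. fun_class E (\<lambda>P. g (\<phi> P))) ` carrier (rational_functions E')"
    by (simp add: carrier_function_field image_image pullback_fun_class[OF fin] comp_def)
  have rat: "rational_fun E h" if "h \<in> ?S us" for h
    by (rule pullback_span_rational[OF that]) (use Cons.prems(1) in auto)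
  have u: "rational_fun E u" using Cons.prems by simp
  have comb: "fun_class E (\<lambda>P. g (\<phi> P)) \<otimes>\<^bsub>function_field E\<^esub> fun_class E u \<oplus>\<^bsub>function_field E\<^esub> fun_class E h
      = fun_class E (\<lambda>P. g (\<phi> P) * u P + h P)" if "rational_fun E' g" "h \<in> ?S us" for g h
    unfolding fun_class_mult[OF pull[OF that(1)] u]
    by (rule fun_class_add[OF rational_fun_mult[OF pull[OF that(1)] u] rat[OF that(2)]])
  have "fun_class E ` ?S (u # us) = F.line_extension ?K (fun_class E u) (fun_class E ` ?S us)"
  proof (intro equalityI subsetI)
    fix x assume "x \<in> fun_class E ` ?S (u # us)"
    then obtain f g h where "x = fun_class E f" "rational_fun E' g" "h \<in> ?S us"
      "eventually (\<lambda>P. f P = g (\<phi> P) * u P + h P) (almost_all_points E)" by auto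
    then have "x = fun_class E (\<lambda>P. g (\<phi> P) * u P + h P)" "rational_fun E' g" "h \<in> ?S us"
      by (simp_all add: fun_class_eq_iff)
    then show "x \<in> F.line_extension ?K (fun_class E u) (fun_class E ` ?S us)"
      unfolding F.line_extension_mem_iff K using comb[of g h] by (auto intro!: bexI)
  next
    fix x assume "x \<in> F.line_extension ?K (fun_class E u) (fun_class E ` ?S us)"
    then obtain g h where "rational_fun E' g" "h \<in> ?S us" "x = fun_class E (\<lambda>P. g (\<phi> P) * u P + h P)"
      unfolding F.line_extension_mem_iff K using comb by auto
    moreover from this have "(\<lambda>P. g (\<phi> P) * u P + h P) \<in> ?S (u # us)"
      unfolding pullback_span.simps mem_Collect_eq
      by (intro exI[of _ g] conjI bexI[of _ h]) auto
    ultimately show "x \<in> fun_class E ` ?S (u # us)"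
      by blast
  qed
  moreover have "fun_class E u \<notin> fun_class E ` ?S us"
  proof
    assume "fun_class E u \<in> fun_class E ` ?S us"
    then obtain f where f: "f \<in> ?S us" "fun_class E f = fun_class E u"
      by (elim imageE) auto
    from f(2) have "eventually (\<lambda>P. f P = u P) (almost_all_points E)"
      by (rule fun_class_eq_iff[THEN iffD1])
    with f(1) have "u \<in> ?S us" by (rule pullback_span_cong)
    with Cons.prems show False by simp
  qed
  moreover have "fun_class E u \<in> carrier (function_field E)"
    using u by (simp add: carrier_function_field)
  ultimately show ?case
    using F.Suc_dim Cons by simp
qed

lemma has_degreeI:
  assumes "\<And>u. u \<in> set us \<Longrightarrow> rational_fun E u" "pullback_independent E E' \<phi> us"
    and "\<And>f. rational_fun E f \<Longrightarrow> f \<in> pullback_span E E' \<phi> us"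
  shows "has_degree E E' \<phi> (length us)"
proof -
  have "pullback_span E E' \<phi> us = carrier (rational_functions E)"
    using assms(1,3) pullback_span_rational by blast
  then show ?thesis
    unfolding has_degree_def using dimension_pullback_span[OF assms(1,2)] by (simp add: carrier_function_field)
qed

end

subsection \<open>Double covers\<close>

text \<open>Coefficient families are kept here because the forms are about to be expanded into
  monomials in the coordinates.\<close>

lemma rational_fun_form_at_iff:
  "rational_fun E f \<longleftrightarrow> (\<exists>d a b.
     eventually (\<lambda>P. form_at d b P \<noteq> 0 \<and> f P = form_at d a P / form_at d b P) (almost_all_points E))"
  by (simp add: rational_functions_def eventually_almost_all_points)

text \<open>
  The assumptions make \<open>u\<close> a generator of the function field of \<open>E\<close> over that of \<open>E'\<close>, with trace
  \<open>\<sigma>\<close> and norm \<open>\<nu>\<close>.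
\<close>

locale double_cover =
  fixes E E' :: "'k::alg_closed_field weierstrass" and \<phi> :: "'k point \<Rightarrow> 'k point"
    and u \<sigma> \<nu> :: "'k point \<Rightarrow> 'k"
  assumes maps: "\<phi> ` points E \<subseteq> points E'"
    and finite_fibre: "P \<in> points E' \<Longrightarrow> finite {Q \<in> points E. \<phi> Q = P}"
    and rational_x: "rational_fun E (\<lambda>P. x_coord (\<phi> P))"
    and rational_y: "rational_fun E (\<lambda>P. y_coord (\<phi> P))"
    and rational_u: "rational_fun E u"
    and rational_trace: "rational_fun E' \<sigma>"
    and rational_norm: "rational_fun E' \<nu>"
    and quadratic: "eventually (\<lambda>P. u P ^ 2 = \<sigma> (\<phi> P) * u P - \<nu> (\<phi> P)) (almost_all_points E)"
    and separating: "eventually (\<lambda>R. \<exists>P\<in>points E. \<exists>Q\<in>points E. \<phi> P = R \<and> \<phi> Q = R \<and> u P \<noteq> u Q)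
      (almost_all_points E')"
    and x_span: "\<exists>g h. rational_fun E' g \<and> rational_fun E' h \<and>
      eventually (\<lambda>P. x_coord P = g (\<phi> P) + h (\<phi> P) * u P) (almost_all_points E)"
    and y_span: "\<exists>g h. rational_fun E' g \<and> rational_fun E' h \<and>
      eventually (\<lambda>P. y_coord P = g (\<phi> P) + h (\<phi> P) * u P) (almost_all_points E)"
begin

lemma filterlim: "filterlim \<phi> (almost_all_points E') (almost_all_points E)"
  using maps finite_fibre by (rule filterlim_almost_all_points)

lemmas eventually_pullback = eventually_compose_filterlim[OF _ filterlim]

text \<open>Numerator and denominator become polynomials in the coordinates of
  \<open>\<phi> P\<close>, which are rational on \<open>E\<close>. The denominator stays nonzero
  almost everywhere because fibres are finite.\<close>

lemma rational_fun_pullback: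
  assumes "rational_fun E' g"
  shows "rational_fun E (\<lambda>P. g (\<phi> P))"
proof -
  from assms obtain d a b where
    ab: "eventually (\<lambda>P. form_at d b P \<noteq> 0 \<and> g P = form_at d a P / form_at d b P) (almost_all_points E')"
    unfolding rational_fun_form_at_iff by blast
  have form: "rational_fun E (\<lambda>P. form_at d c (\<phi> P))" for c
  proof (rule rational_fun_cong)
    show "rational_fun E (\<lambda>P. \<Sum>i\<le>d. \<Sum>j\<le>d - i. c i j * x_coord (\<phi> P) ^ i * y_coord (\<phi> P) ^ j)"
      by (rule rational_fun_sum)+
         (rule rational_fun_mult[OF rational_fun_mult[OF rational_fun_const
            rational_fun_power[OF rational_x]] rational_fun_power[OF rational_y]])
    show "eventually (\<lambda>P. (\<Sum>i\<le>d. \<Sum>j\<le>d - i. c i j * x_coord (\<phi> P) ^ i * y_coord (\<phi> P) ^ j) =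
        form_at d c (\<phi> P)) (almost_all_points E)"
      using eventually_pullback[OF eventually_affine] by eventually_elim (simp add: form_at_affine)
  qed
  from eventually_pullback[OF ab] have ab': "eventually (\<lambda>P. form_at d b (\<phi> P) \<noteq> 0 \<and>
    g (\<phi> P) = form_at d a (\<phi> P) / form_at d b (\<phi> P)) (almost_all_points E)" .
  have "rational_fun E (\<lambda>P. form_at d a (\<phi> P) / form_at d b (\<phi> P))"
    by (rule rational_fun_divide[OF form form]) (use ab' in eventually_elim, simp)
  then show ?thesis
    by (rule rational_fun_cong) (use ab' in eventually_elim, simp)
qed

text \<open>The points where \<open>p\<close> fails form a finite set with finite image. Away from
  that image all points of a fibre satisfy \<open>p\<close>, in particular two that \<open>u\<close>
  separates.\<close>

lemma eventually_fibre:
  assumes "eventually p (almost_all_points E)"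
  shows "eventually (\<lambda>R. \<exists>P Q. p P \<and> p Q \<and> \<phi> P = R \<and> \<phi> Q = R \<and> u P \<noteq> u Q) (almost_all_points E')"
proof -
  have "finite (\<phi> ` {P \<in> points E. \<not> p P})"
    using assms by (simp add: eventually_almost_all_points)
  then have "eventually (\<lambda>R. R \<notin> \<phi> ` {P \<in> points E. \<not> p P}) (almost_all_points E')"
    unfolding eventually_almost_all_points by (rule finite_subset[rotated]) auto
  with separating show ?thesis
  proof eventually_elim
    case (elim R)
    then obtain P Q where PQ: "P \<in> points E" "Q \<in> points E" "\<phi> P = R" "\<phi> Q = R" "u P \<noteq> u Q" by blast
    have "p S" if "S \<in> points E" "\<phi> S = R" for S
      using elim(2) that by auto
    from this[OF PQ(1,3)] this[OF PQ(2,4)] PQ show ?case by (intro exI[of _ P] exI[of _ Q]) simp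
  qed
qed

text \<open>Two explicit coefficients instead of the nested form of \<open>pullback_span\<close>, so
  that products and inverses can be computed by formulas.\<close>

definition span :: "('k point \<Rightarrow> 'k) set" where
  "span = {f. \<exists>g h. rational_fun E' g \<and> rational_fun E' h \<and>
      eventually (\<lambda>P. f P = g (\<phi> P) + h (\<phi> P) * u P) (almost_all_points E)}"

lemma spanE:
  assumes "f \<in> span"
  obtains g h where "rational_fun E' g" "rational_fun E' h"
    "eventually (\<lambda>P. f P = g (\<phi> P) + h (\<phi> P) * u P) (almost_all_points E)"
  using assms unfolding span_def by blast

lemma spanI:
  assumes "rational_fun E' g" "rational_fun E' h"
    "eventually (\<lambda>P. f P = g (\<phi> P) + h (\<phi> P) * u P) (almost_all_points E)"
  shows "f \<in> span"
  using assms unfolding span_def by blast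

lemma span_cong:
  assumes "f \<in> span" "eventually (\<lambda>P. f' P = f P) (almost_all_points E)"
  shows "f' \<in> span"
proof -
  from assms(1) obtain g h where gh: "rational_fun E' g" "rational_fun E' h"
    "eventually (\<lambda>P. f P = g (\<phi> P) + h (\<phi> P) * u P) (almost_all_points E)" by (rule spanE)
  show ?thesis
    by (rule spanI[OF gh(1,2)]) (use gh(3) assms(2) in eventually_elim, simp)
qed

lemma span_const: "(\<lambda>P. a) \<in> span"
  by (rule spanI[of "\<lambda>R. a" "\<lambda>R. 0"]) (simp_all add: rational_fun_const)

lemma span_add:
  assumes "f \<in> span" "f' \<in> span"
  shows "(\<lambda>P. f P + f' P) \<in> span"
proof -
  from assms(1) obtain g h where gh: "rational_fun E' g" "rational_fun E' h"
    "eventually (\<lambda>P. f P = g (\<phi> P) + h (\<phi> P) * u P) (almost_all_points E)" by (rule spanE)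
  from assms(2) obtain g' h' where gh': "rational_fun E' g'" "rational_fun E' h'"
    "eventually (\<lambda>P. f' P = g' (\<phi> P) + h' (\<phi> P) * u P) (almost_all_points E)" by (rule spanE)
  show ?thesis
    by (rule spanI[OF rational_fun_add[OF gh(1) gh'(1)] rational_fun_add[OF gh(2) gh'(2)]])
       (use gh(3) gh'(3) in eventually_elim, simp add: algebra_simps)
qed

text \<open>Multiply out and reduce the square of \<open>u\<close> with the quadratic
  relation.\<close>

lemma span_mult:
  assumes "f \<in> span" "f' \<in> span"
  shows "(\<lambda>P. f P * f' P) \<in> span"
proof -
  from assms(1) obtain g h where gh: "rational_fun E' g" "rational_fun E' h"
    "eventually (\<lambda>P. f P = g (\<phi> P) + h (\<phi> P) * u P) (almost_all_points E)" by (rule spanE)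
  from assms(2) obtain g' h' where gh': "rational_fun E' g'" "rational_fun E' h'"
    "eventually (\<lambda>P. f' P = g' (\<phi> P) + h' (\<phi> P) * u P) (almost_all_points E)" by (rule spanE)
  show ?thesis
  proof (rule spanI)
    show "rational_fun E' (\<lambda>R. g R * g' R - h R * h' R * \<nu> R)"
      "rational_fun E' (\<lambda>R. g R * h' R + h R * g' R + h R * h' R * \<sigma> R)"
      by (intro rational_fun_diff rational_fun_add rational_fun_mult gh gh' rational_norm rational_trace)+
    show "eventually (\<lambda>P. f P * f' P = (g (\<phi> P) * g' (\<phi> P) - h (\<phi> P) * h' (\<phi> P) * \<nu> (\<phi> P)) +
       (g (\<phi> P) * h' (\<phi> P) + h (\<phi> P) * g' (\<phi> P) + h (\<phi> P) * h' (\<phi> P) * \<sigma> (\<phi> P)) * u P) (almost_all_points E)"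
      using gh(3) gh'(3) quadratic
    proof eventually_elim
      case (elim P)
      then have \<nu>: "\<nu> (\<phi> P) = \<sigma> (\<phi> P) * u P - u P ^ 2" by simp
      show ?case unfolding elim(1,2) \<nu> by (simp add: algebra_simps power2_eq_square)
    qed
  qed
qed

lemma span_power: "f \<in> span \<Longrightarrow> (\<lambda>P. f P ^ n) \<in> span"
  by (induction n) (auto intro: span_const span_mult)

lemma span_sum: "(\<And>i. i \<in> A \<Longrightarrow> f i \<in> span) \<Longrightarrow> (\<lambda>P. \<Sum>i\<in>A. f i P) \<in> span"
  by (induction A rule: infinite_finite_induct) (auto intro: span_const span_add)

text \<open>The conjugate of g + h u is g + h sigma - h u, and their product is the norm
  \<open>N\<close>, so the inverse is the conjugate divided by \<open>N\<close>. The point is that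
  \<open>N\<close> is nonzero almost everywhere: at R it is the product of the values of
  \<open>f\<close> at two points of the fibre, both nonzero for almost all R.\<close>

lemma span_inverse:
  assumes "f \<in> span" and nz: "eventually (\<lambda>P. f P \<noteq> 0) (almost_all_points E)"
  shows "(\<lambda>P. inverse (f P)) \<in> span"
proof -
  from assms(1) obtain g h where gh: "rational_fun E' g" "rational_fun E' h"
    "eventually (\<lambda>P. f P = g (\<phi> P) + h (\<phi> P) * u P) (almost_all_points E)" by (rule spanE)
  define N where "N = (\<lambda>R. g R ^ 2 + g R * h R * \<sigma> R + h R ^ 2 * \<nu> R)"
  have N: "rational_fun E' N"
    unfolding N_def
    by (intro rational_fun_add rational_fun_mult rational_fun_power gh rational_norm rational_trace)
  have "eventually (\<lambda>P. f P = g (\<phi> P) + h (\<phi> P) * u P \<and> f P \<noteq> 0 \<and>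
      u P ^ 2 = \<sigma> (\<phi> P) * u P - \<nu> (\<phi> P)) (almost_all_points E)"
    using gh(3) nz quadratic by eventually_elim simp
  from eventually_fibre[OF this] have N_nz: "eventually (\<lambda>R. N R \<noteq> 0) (almost_all_points E')"
  proof eventually_elim
    case (elim R)
    then obtain P Q where PQ: "g R + h R * u P \<noteq> 0" "g R + h R * u Q \<noteq> 0" "u P \<noteq> u Q"
      "u P ^ 2 = \<sigma> R * u P - \<nu> R" "u Q ^ 2 = \<sigma> R * u Q - \<nu> R" by auto
    \<comment> \<open>Both values are roots of the same monic quadratic and they differ, so Vieta's
      formulas give the trace and the norm at R.\<close>
    have "(u P - u Q) * (u P + u Q - \<sigma> R) = (u P ^ 2 - \<sigma> R * u P) - (u Q ^ 2 - \<sigma> R * u Q)"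
      by (simp add: algebra_simps power2_eq_square)
    also have "\<dots> = 0"
      by (simp add: PQ(4,5))
    finally have "(u P - u Q) * (u P + u Q - \<sigma> R) = 0" .
    with PQ(3) have "\<sigma> R = u P + u Q" by simp
    moreover from this PQ(4) have "\<nu> R = u P * u Q"
      by (simp add: algebra_simps power2_eq_square)
    ultimately have "N R = (g R + h R * u P) * (g R + h R * u Q)"
      unfolding N_def by (simp add: algebra_simps power2_eq_square)
    with PQ(1,2) show ?case by simp
  qed
  show ?thesis
  proof (rule spanI)
    show "rational_fun E' (\<lambda>R. (g R + h R * \<sigma> R) / N R)" "rational_fun E' (\<lambda>R. - h R / N R)"
      by (intro rational_fun_divide[OF _ N N_nz] rational_fun_add rational_fun_mult rational_fun_uminus
          gh rational_trace)+
    show "eventually (\<lambda>P. inverse (f P) = (g (\<phi> P) + h (\<phi> P) * \<sigma> (\<phi> P)) / N (\<phi> P) +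
       (- h (\<phi> P) / N (\<phi> P)) * u P) (almost_all_points E)"
      using gh(3) nz quadratic eventually_pullback[OF N_nz]
    proof eventually_elim
      case (elim P)
      then have \<nu>: "\<nu> (\<phi> P) = \<sigma> (\<phi> P) * u P - u P ^ 2" by simp
      have "f P * (g (\<phi> P) + h (\<phi> P) * \<sigma> (\<phi> P) - h (\<phi> P) * u P) = N (\<phi> P)"
        unfolding N_def elim(1) \<nu> by (simp add: algebra_simps power2_eq_square)
      with elim(2,4) have "inverse (f P) = (g (\<phi> P) + h (\<phi> P) * \<sigma> (\<phi> P) - h (\<phi> P) * u P) / N (\<phi> P)"
        by (simp add: field_simps)
      then show ?case
        by (simp add: add_divide_distrib diff_divide_distrib)
    qed
  qed
qed

text \<open>The span contains the constants and both coordinates and is closed under sums, products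
  and inverses, hence contains every quotient of forms.\<close>

lemma rational_fun_in_span:
  assumes "rational_fun E f"
  shows "f \<in> span"
proof -
  from assms obtain d a b where
    ab: "eventually (\<lambda>P. form_at d b P \<noteq> 0 \<and> f P = form_at d a P / form_at d b P) (almost_all_points E)"
    unfolding rational_fun_form_at_iff by blast
  have x: "x_coord \<in> span" and y: "y_coord \<in> span"
    using x_span y_span unfolding span_def by auto
  have form: "form_at d c \<in> span" for c
  proof (rule span_cong)
    show "(\<lambda>P. \<Sum>i\<le>d. \<Sum>j\<le>d - i. c i j * x_coord P ^ i * y_coord P ^ j) \<in> span"
      by (rule span_sum)+ (rule span_mult[OF span_mult[OF span_const span_power[OF x]] span_power[OF y]])
    show "eventually (\<lambda>P. form_at d c P = (\<Sum>i\<le>d. \<Sum>j\<le>d - i. c i j * x_coord P ^ i * y_coord P ^ j))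
        (almost_all_points E)"
      using eventually_affine by eventually_elim (simp add: form_at_affine)
  qed
  have "(\<lambda>P. form_at d a P * inverse (form_at d b P)) \<in> span"
    by (intro span_mult[OF form] span_inverse[OF form]) (use ab in eventually_elim, simp)
  then show ?thesis
    by (rule span_cong) (use ab in eventually_elim, simp add: divide_inverse)
qed

text \<open>The relation holds at two points of a fibre with the same \<open>g R\<close> and
  \<open>h R\<close> but different \<open>u\<close>; subtracting gives \<open>h R = 0\<close>, then
  \<open>g R = 0\<close>.\<close>

lemma independent:
  assumes "eventually (\<lambda>P. g (\<phi> P) + h (\<phi> P) * u P = 0) (almost_all_points E)"
  shows "eventually (\<lambda>R. g R = 0) (almost_all_points E')" "eventually (\<lambda>R. h R = 0) (almost_all_points E')"
proof -
  from eventually_fibre[OF assms] have "eventually (\<lambda>R. g R = 0 \<and> h R = 0) (almost_all_points E')"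
  proof eventually_elim
    case (elim R)
    then obtain P Q where PQ: "g R + h R * u P = 0" "g R + h R * u Q = 0" "u P \<noteq> u Q" by auto
    have "h R * (u P - u Q) = (g R + h R * u P) - (g R + h R * u Q)"
      by (simp add: algebra_simps)
    with PQ(1,2) have "h R * (u P - u Q) = 0" by simp
    with PQ show ?case by auto
  qed
  then show "eventually (\<lambda>R. g R = 0) (almost_all_points E')" "eventually (\<lambda>R. h R = 0) (almost_all_points E')"
    by (auto elim: eventually_mono)
qed

end

text \<open>The multiplicativity of degrees in a tower, carried out on the product basis vu, u, v,
  1: a relation is first split along 1, u over the middle curve, then along 1, v over the last
  one.\<close>

lemma has_degree_4_compose_double_covers:
  assumes "double_cover E E' \<phi> u \<sigma> \<nu>" "double_cover E' E'' \<psi> v \<tau> \<mu>"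
    and inf: "infinite (points E'')"
  shows "has_degree E E'' (\<psi> \<circ> \<phi>) 4"
proof -
  interpret \<phi>: double_cover E E' \<phi> u \<sigma> \<nu> by fact
  interpret \<psi>: double_cover E' E'' \<psi> v \<tau> \<mu> by fact
  let ?w = "\<lambda>P. v (\<phi> P) * u P"
  have lim: "filterlim (\<psi> \<circ> \<phi>) (almost_all_points E'') (almost_all_points E)"
    using filterlim_compose[OF \<psi>.filterlim \<phi>.filterlim] by (simp add: comp_def)
  have pull: "rational_fun E (\<lambda>P. g ((\<psi> \<circ> \<phi>) P))" if "rational_fun E'' g" for g
    using \<phi>.rational_fun_pullback[OF \<psi>.rational_fun_pullback[OF that]] by simp
  have indep: "eventually (\<lambda>R. a R = 0) (almost_all_points E'')" "eventually (\<lambda>R. b R = 0) (almost_all_points E'')"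
    "eventually (\<lambda>R. c R = 0) (almost_all_points E'')" "eventually (\<lambda>R. d R = 0) (almost_all_points E'')"
    if "eventually (\<lambda>P. a (\<psi> (\<phi> P)) * (v (\<phi> P) * u P) + b (\<psi> (\<phi> P)) * u P +
      c (\<psi> (\<phi> P)) * v (\<phi> P) + d (\<psi> (\<phi> P)) = 0) (almost_all_points E)" for a b c d
  proof -
    from that have "eventually (\<lambda>P. (d (\<psi> (\<phi> P)) + c (\<psi> (\<phi> P)) * v (\<phi> P)) +
        (b (\<psi> (\<phi> P)) + a (\<psi> (\<phi> P)) * v (\<phi> P)) * u P = 0) (almost_all_points E)"
      by eventually_elim (simp add: algebra_simps)
    note \<phi>.independent[OF this]
    note \<psi>.independent[OF this(1)] \<psi>.independent[OF this(2)]
    then show "eventually (\<lambda>R. a R = 0) (almost_all_points E'')" "eventually (\<lambda>R. b R = 0) (almost_all_points E'')"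
      "eventually (\<lambda>R. c R = 0) (almost_all_points E'')" "eventually (\<lambda>R. d R = 0) (almost_all_points E'')"
      by simp_all
  qed
  \<comment> \<open>On an infinite curve a nonzero constant cannot vanish at almost all points; on a
    finite one every statement would hold almost everywhere.\<close>
  have one: "\<not> eventually (\<lambda>R. - 1 = (0::'a)) (almost_all_points E'')"
    using inf by (simp add: eventually_almost_all_points)
  have "pullback_independent E E'' (\<psi> \<circ> \<phi>) [?w, u, \<lambda>P. v (\<phi> P), \<lambda>P. 1]"
    unfolding pullback_independent.simps
  proof (intro conjI notI)
    \<comment> \<open>In each of the four cases, moving the dependent element across gives a
      relation in which its own coefficient is the constant -1, against \<open>indep\<close> and
      \<open>one\<close>.\<close>
    assume "?w \<in> pullback_span E E'' (\<psi> \<circ> \<phi>) [u, \<lambda>P. v (\<phi> P), \<lambda>P. 1]"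
    then obtain b h1 c h2 d h3 where
      "eventually (\<lambda>P. ?w P = b ((\<psi> \<circ> \<phi>) P) * u P + h1 P) (almost_all_points E)"
      "eventually (\<lambda>P. h1 P = c ((\<psi> \<circ> \<phi>) P) * v (\<phi> P) + h2 P) (almost_all_points E)"
      "eventually (\<lambda>P. h2 P = d ((\<psi> \<circ> \<phi>) P) * 1 + h3 P) (almost_all_points E)"
      "eventually (\<lambda>P. h3 P = 0) (almost_all_points E)"
      unfolding pullback_span.simps by blast
    then have "eventually (\<lambda>P. -1 * (v (\<phi> P) * u P) + b (\<psi> (\<phi> P)) * u P +
      c (\<psi> (\<phi> P)) * v (\<phi> P) + d (\<psi> (\<phi> P)) = 0) (almost_all_points E)"
      by eventually_elim simp
    from indep(1)[of "\<lambda>R. - 1", OF this] one show False by simp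
  next
    assume "u \<in> pullback_span E E'' (\<psi> \<circ> \<phi>) [\<lambda>P. v (\<phi> P), \<lambda>P. 1]"
    then obtain c h2 d h3 where
      "eventually (\<lambda>P. u P = c ((\<psi> \<circ> \<phi>) P) * v (\<phi> P) + h2 P) (almost_all_points E)"
      "eventually (\<lambda>P. h2 P = d ((\<psi> \<circ> \<phi>) P) * 1 + h3 P) (almost_all_points E)"
      "eventually (\<lambda>P. h3 P = 0) (almost_all_points E)"
      unfolding pullback_span.simps by blast
    then have "eventually (\<lambda>P. 0 * (v (\<phi> P) * u P) + -1 * u P +
      c (\<psi> (\<phi> P)) * v (\<phi> P) + d (\<psi> (\<phi> P)) = 0) (almost_all_points E)"
      by eventually_elim simp
    from indep(2)[of "\<lambda>R. 0" "\<lambda>R. - 1", OF this] one show False by simp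
  next
    assume "(\<lambda>P. v (\<phi> P)) \<in> pullback_span E E'' (\<psi> \<circ> \<phi>) [\<lambda>P. 1]"
    then obtain d h3 where
      "eventually (\<lambda>P. v (\<phi> P) = d ((\<psi> \<circ> \<phi>) P) * 1 + h3 P) (almost_all_points E)"
      "eventually (\<lambda>P. h3 P = 0) (almost_all_points E)"
      unfolding pullback_span.simps by blast
    then have "eventually (\<lambda>P. 0 * (v (\<phi> P) * u P) + 0 * u P +
      -1 * v (\<phi> P) + d (\<psi> (\<phi> P)) = 0) (almost_all_points E)"
      by eventually_elim simp
    from indep(3)[of "\<lambda>R. 0" "\<lambda>R. 0" "\<lambda>R. - 1", OF this] one show False by simp
  next
    assume "(\<lambda>P. 1) \<in> pullback_span E E'' (\<psi> \<circ> \<phi>) []"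
    then have "eventually (\<lambda>P. 0 * (v (\<phi> P) * u P) + 0 * u P + 0 * v (\<phi> P) + - 1 = 0) (almost_all_points E)"
      by simp
    from indep(4)[of "\<lambda>R. 0" "\<lambda>R. 0" "\<lambda>R. 0" "\<lambda>R. - 1", OF this] one show False by simp
  qed simp
  moreover have "f \<in> pullback_span E E'' (\<psi> \<circ> \<phi>) [?w, u, \<lambda>P. v (\<phi> P), \<lambda>P. 1]" if f: "rational_fun E f" for f
  proof -
    from \<phi>.rational_fun_in_span[OF f] obtain g h where gh: "rational_fun E' g" "rational_fun E' h"
      "eventually (\<lambda>P. f P = g (\<phi> P) + h (\<phi> P) * u P) (almost_all_points E)" by (rule \<phi>.spanE)
    from \<psi>.rational_fun_in_span[OF gh(1)] obtain d c where dc: "rational_fun E'' d" "rational_fun E'' c"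
      "eventually (\<lambda>P. g P = d (\<psi> P) + c (\<psi> P) * v P) (almost_all_points E')" by (rule \<psi>.spanE)
    from \<psi>.rational_fun_in_span[OF gh(2)] obtain b a where ba: "rational_fun E'' b" "rational_fun E'' a"
      "eventually (\<lambda>P. h P = b (\<psi> P) + a (\<psi> P) * v P) (almost_all_points E')" by (rule \<psi>.spanE)
    \<comment> \<open>The partial sums, from the last basis element backwards, that witness the
      nested existentials of \<open>pullback_span\<close>.\<close>
    define h2 where "h2 = (\<lambda>P. d ((\<psi> \<circ> \<phi>) P) * 1 + 0)"
    define h1 where "h1 = (\<lambda>P. c ((\<psi> \<circ> \<phi>) P) * v (\<phi> P) + h2 P)"
    define h0 where "h0 = (\<lambda>P. b ((\<psi> \<circ> \<phi>) P) * u P + h1 P)"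
    have "h2 \<in> pullback_span E E'' (\<psi> \<circ> \<phi>) [\<lambda>P. 1]"
      unfolding pullback_span.simps mem_Collect_eq h2_def
      by (intro exI[of _ d] conjI bexI[of _ "\<lambda>P. 0"] dc) simp_all
    then have "h1 \<in> pullback_span E E'' (\<psi> \<circ> \<phi>) [\<lambda>P. v (\<phi> P), \<lambda>P. 1]"
      unfolding pullback_span.simps(2)[of _ _ _ "\<lambda>P. v (\<phi> P)"] mem_Collect_eq h1_def
      by (intro exI[of _ c] conjI bexI[of _ h2] dc) simp_all
    then have "h0 \<in> pullback_span E E'' (\<psi> \<circ> \<phi>) [u, \<lambda>P. v (\<phi> P), \<lambda>P. 1]"
      unfolding pullback_span.simps(2)[of _ _ _ "u"] mem_Collect_eq h0_def
      by (intro exI[of _ b] conjI bexI[of _ h1] ba) simp_all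
    moreover have "eventually (\<lambda>P. f P = a ((\<psi> \<circ> \<phi>) P) * ?w P + h0 P) (almost_all_points E)"
      using gh(3) \<phi>.eventually_pullback[OF dc(3)] \<phi>.eventually_pullback[OF ba(3)]
      by eventually_elim (simp add: h0_def h1_def h2_def algebra_simps)
    ultimately show ?thesis
      unfolding pullback_span.simps(2)[of _ _ _ ?w] mem_Collect_eq
      by (intro exI[of _ a] conjI bexI[of _ h0] ba)
  qed
  moreover have "rational_fun E f" if "f \<in> set [?w, u, \<lambda>P. v (\<phi> P), \<lambda>P. 1]" for f
    using that \<phi>.rational_u rational_fun_mult[OF \<phi>.rational_fun_pullback[OF \<psi>.rational_u] \<phi>.rational_u]
      \<phi>.rational_fun_pullback[OF \<psi>.rational_u] rational_fun_const[of 1 E] by auto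
  ultimately have "has_degree E E'' (\<psi> \<circ> \<phi>) (length [?w, u, \<lambda>P. v (\<phi> P), \<lambda>P. 1])"
    by (intro has_degreeI[OF lim] pull)
  then show ?thesis by (simp add: eval_nat_numeral)
qed

subsection \<open>The two isogenies of degree two\<close>

lemma proj_eq_affineI: "C \<noteq> 0 \<Longrightarrow> A = C * x \<Longrightarrow> B = C * y \<Longrightarrow> proj_eq (A, B, C) (homog_coords (Affine x y))"
  by (auto simp: proj_eq_def intro!: exI[of _ C])

lemma proj_eq_InfinityI: "A = 0 \<Longrightarrow> C = 0 \<Longrightarrow> B \<noteq> 0 \<Longrightarrow> proj_eq (A, B, C) (homog_coords Infinity)"
  by (auto simp: proj_eq_def intro!: exI[of _ B])

lemma finite_quadratic_roots:
  fixes a b c :: "'k::field"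
  assumes "a \<noteq> 0 \<or> b \<noteq> 0 \<or> c \<noteq> 0"
  shows "finite {x. a * x ^ 2 + b * x + c = 0}"
proof -
  have "{x. a * x ^ 2 + b * x + c = 0} = {x. poly [:c, b, a:] x = 0}"
    by (auto simp: power2_eq_square algebra_simps)
  moreover have "[:c, b, a:] \<noteq> 0" using assms by auto
  ultimately show ?thesis using poly_roots_finite[of "[:c, b, a:]"] by simp
qed

lemma quadratic_root_exists:
  fixes b c :: "'k::alg_closed_field"
  obtains x where "x ^ 2 = b * x - c"
proof -
  have "degree [:c, - b, 1:] > 0" by simp
  then obtain x where "poly [:c, - b, 1:] x = 0"
    using alg_closed_imp_poly_has_root by blast
  then have "c + x * (x - b) = 0" by (simp add: algebra_simps)
  then have "x ^ 2 = b * x - c" by Groebner_Basis.algebra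
  then show thesis by (rule that)
qed

lemma finite_points_over:
  assumes "finite A"
  shows "finite {P \<in> points E. P = Infinity \<or> x_coord P \<in> A}"
proof -
  obtain a1 a2 a3 a4 a6 where E: "E = Weierstrass a1 a2 a3 a4 a6" by (cases E)
  define ys where "ys = (\<lambda>x. {y. 1 * y ^ 2 + (a1 * x + a3) * y + (- (x ^ 3 + a2 * x ^ 2 + a4 * x + a6)) = 0})"
  have "finite (insert Infinity (\<Union>x\<in>A. Affine x ` ys x))"
    using assms unfolding ys_def by (intro finite.insertI finite_UN_I finite_imageI finite_quadratic_roots) auto
  moreover have "{P \<in> points E. P = Infinity \<or> x_coord P \<in> A} \<subseteq> insert Infinity (\<Union>x\<in>A. Affine x ` ys x)"
  proof
    fix P assume P: "P \<in> {P \<in> points E. P = Infinity \<or> x_coord P \<in> A}"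
    show "P \<in> insert Infinity (\<Union>x\<in>A. Affine x ` ys x)"
    proof (cases P)
      case (Affine x y)
      with P have "x \<in> A" "y \<in> ys x"
        by (auto simp: points_def E ys_def algebra_simps)
      with Affine show ?thesis by auto
    qed simp
  qed
  ultimately show ?thesis by (rule finite_subset[rotated])
qed

text \<open>The source of all genericity statements below: finitely many abscissas, where
  denominators or discriminants vanish, may be excluded together with
  \<open>Infinity\<close>.\<close>

lemma eventually_x_coord:
  assumes "finite A"
  shows "eventually (\<lambda>P. \<exists>x y. P = Affine x y \<and> x \<notin> A \<and> on_curve E (Affine x y)) (almost_all_points E)"
  unfolding eventually_almost_all_points
proof (rule finite_subset[OF _ finite_points_over[OF assms]], rule subsetI)
  fix P assume P: "P \<in> {P \<in> points E. \<nexists>x y. P = Affine x y \<and> x \<notin> A \<and> on_curve E (Affine x y)}"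
  then show "P \<in> {P \<in> points E. P = Infinity \<or> x_coord P \<in> A}"
    by (cases P) (auto simp: points_def)
qed

text \<open>Every element of the infinite ground field is an abscissa, since the quadratic equation
  for the ordinate has a root.\<close>

lemma infinite_points:
  fixes E :: "'k::{alg_closed_field, field_char_0} weierstrass"
  shows "infinite (points E)"
proof
  assume fin: "finite (points E)"
  obtain a1 a2 a3 a4 a6 where E: "E = Weierstrass a1 a2 a3 a4 a6" by (cases E)
  have "x \<in> x_coord ` points E" for x
  proof -
    obtain y where "y ^ 2 = (- a1 * x - a3) * y - (- (x ^ 3 + a2 * x ^ 2 + a4 * x + a6))"
      by (rule quadratic_root_exists)
    then have "Affine x y \<in> points E"
      by (simp add: points_def E algebra_simps)
    then show ?thesis by (rule image_eqI[rotated]) simp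
  qed
  then have "x_coord ` points E = UNIV" by auto
  with fin show False using infinite_UNIV_char_0 by (metis finite_imageI)
qed

section \<open>Explicit formulas for the two isogenies\<close>

text \<open>The constant \<open>k\<close> rescales ordinates when abscissas are multiplied by -1/4:
  its square is the cube (-1/4)^3 = -1/64.\<close>

locale tate_pair =
  fixes t T k :: "'k::{alg_closed_field, field_char_0}"
  assumes t: "t \<noteq> 0" and T: "T \<noteq> 0" and sum: "16 * t + 16 * T = 1" and k: "64 * k ^ 2 = - 1"
begin

text \<open>
  Since \<open>16 (t + T) = 1\<close>, the constants 1/2 and 1/4 are polynomials in \<open>t\<close> and \<open>T\<close>, which keeps
  denominators out of the Groebner basis computations.
\<close>

definition half :: 'k where "half = 8 * (t + T)"
definition quarter :: 'k where "quarter = 4 * (t + T)"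

lemma half: "2 * half = 1" and quarter: "4 * quarter = 1"
  using sum by (simp_all add: half_def quarter_def algebra_simps)

lemma half_square: "half ^ 2 = quarter"
  using half quarter sum by Groebner_Basis.algebra

lemma k_nonzero: "k \<noteq> 0"
  using k by auto

lemma quarter_nonzero: "quarter \<noteq> 0"
  using quarter by auto

text \<open>Equal to 4t + 1/4, so that x^2 + A x + t = (x + 4t)(x + 1/4); also equal to 1/2 -
  4T.\<close>

definition A :: 'k where "A = 8 * t + 4 * T"

definition mid :: "'k weierstrass" where "mid = Weierstrass 0 A 0 t 0"

abbreviation tate :: "'k \<Rightarrow> 'k weierstrass" where "tate r \<equiv> Weierstrass 1 r r 0 0"

text \<open>With s = x + t and w = y + s/2 the classical abscissa is w^2/s^2 = x^2/s + 1/4. At (0,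
  0) its value is 1/4, and subtracting this moves the image to the origin. The ordinate is w (t^2 -
  s^2)/s^2, factored by s - t = x and s + t = x + 2t.\<close>

fun isog1 :: "'k point \<Rightarrow> 'k point" where
  "isog1 Infinity = Infinity"
| "isog1 (Affine x y) = (if x + t = 0 then Infinity else
     Affine (x ^ 2 / (x + t)) (- (y + half * (x + t)) * x * (x + 2 * t) / (x + t) ^ 2))"

text \<open>The classical abscissa and ordinate, scaled by -1/4 and \<open>k\<close>, give p and q
  on the completed square of the target. The coordinates p - T and q - p/2 undo the translation and
  the completion of the square.\<close>

fun isog2 :: "'k point \<Rightarrow> 'k point" where
  "isog2 Infinity = Infinity"
| "isog2 (Affine x y) = (if x = 0 then Infinity else
     Affine (- quarter * y ^ 2 / x ^ 2 - T)
       (k * y * (t - x ^ 2) / x ^ 2 + half * quarter * y ^ 2 / x ^ 2))"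

lemma tate_curve_iff:
  "Affine x y \<in> points (tate r) \<longleftrightarrow> y * (y + (x + r)) = x ^ 2 * (x + r)"
  by (simp add: points_def algebra_simps power2_eq_square power3_eq_cube)

lemma mid_curve_iff:
  "Affine x y \<in> points mid \<longleftrightarrow> y ^ 2 = x * (x ^ 2 + A * x + t)"
  by (simp add: points_def mid_def algebra_simps power2_eq_square power3_eq_cube)

text \<open>Completing the square: w^2 = s (x^2 + s/4) for s = x + r and w = y + s/2, a cubic in s
  because x = s - r.\<close>

lemma tate_curve_square:
  assumes "Affine x y \<in> points (tate r)"
  shows "(y + half * (x + r)) ^ 2 = (x + r) * (x ^ 2 + quarter * (x + r))"
proof -
  have "(y + half * (x + r)) ^ 2 = y ^ 2 + 2 * half * y * (x + r) + half ^ 2 * (x + r) ^ 2"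
    by (simp add: algebra_simps power2_eq_square)
  also have "\<dots> = y * (y + (x + r)) + quarter * (x + r) ^ 2"
    unfolding half half_square by (simp add: algebra_simps power2_eq_square)
  finally show ?thesis
    using assms unfolding tate_curve_iff by (simp add: algebra_simps power2_eq_square)
qed

lemma tate_curveI:
  assumes "(y + half * (x + r)) ^ 2 = (x + r) * (x ^ 2 + quarter * (x + r))"
  shows "Affine x y \<in> points (tate r)"
proof -
  have "(y + half * (x + r)) ^ 2 = y ^ 2 + 2 * half * y * (x + r) + half ^ 2 * (x + r) ^ 2"
    by (simp add: algebra_simps power2_eq_square)
  also have "\<dots> = y * (y + (x + r)) + quarter * (x + r) ^ 2"
    unfolding half half_square by (simp add: algebra_simps power2_eq_square)
  finally show ?thesis
    using assms unfolding tate_curve_iff by (simp add: algebra_simps power2_eq_square)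
qed

lemma isog1_maps: "P \<in> points (tate t) \<Longrightarrow> isog1 P \<in> points mid"
proof (cases P)
  case (Affine x y)
  assume P: "P \<in> points (tate t)"
  show ?thesis
  proof (cases "x + t = 0")
    case False
    define s where "s = x + t"
    define p where "p = x ^ 2 / s"
    define q where "q = - (y + half * s) * x * (x + 2 * t) / s ^ 2"
    have s: "s \<noteq> 0" using False by (simp add: s_def)
    have p: "p * s = x ^ 2" and q: "q * s ^ 2 = - (y + half * s) * x * (s + t)"
      using s by (simp_all add: p_def q_def s_def)
    have sq: "(y + half * s) ^ 2 = s * (x ^ 2 + quarter * s)"
      using tate_curve_square[of x y t] P Affine by (simp add: s_def)
    have "q ^ 2 * s ^ 4 = (q * s ^ 2) ^ 2" by (simp add: algebra_simps power2_eq_square eval_nat_numeral)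
    also have "\<dots> = s * (x ^ 2 + quarter * s) * x ^ 2 * (s + t) ^ 2"
      unfolding q sq[symmetric] by (simp add: algebra_simps power2_eq_square)
    also have "\<dots> = s * (p * s + quarter * s) * (p * s) * (p * s + 4 * t * s)"
    proof -
      \<comment> \<open>Since x = s - t, the square of s + t is x^2 + 4ts.\<close>
      have "(s + t) ^ 2 = p * s + 4 * t * s"
        using p s_def by Groebner_Basis.algebra
      then show ?thesis by (simp add: p)
    qed
    also have "\<dots> = s ^ 4 * (p * ((p + quarter) * (p + 4 * t)))"
      by (simp add: algebra_simps eval_nat_numeral)
    also have "(p + quarter) * (p + 4 * t) = p ^ 2 + A * p + t"
      using quarter unfolding A_def quarter_def by Groebner_Basis.algebra
    finally have "q ^ 2 = p * (p ^ 2 + A * p + t)"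
      using s by simp
    then have "Affine p q \<in> points mid"
      unfolding mid_curve_iff .
    then show ?thesis
      using Affine False by (simp add: p_def q_def s_def)
  qed (simp add: Affine points_def)
qed (simp add: points_def)

lemma isog2_maps: "P \<in> points mid \<Longrightarrow> isog2 P \<in> points (tate T)"
proof (cases P)
  case (Affine x y)
  assume P: "P \<in> points mid"
  show ?thesis
  proof (cases "x = 0")
    case x: False
    define v where "v = y ^ 2 / x ^ 2"
    define p where "p = - quarter * v"
    define q where "q = k * y * (t - x ^ 2) / x ^ 2"
    have v: "v * x ^ 2 = y ^ 2" and q: "q * x ^ 2 = k * y * (t - x ^ 2)"
      using x by (simp_all add: v_def q_def)
    from P Affine have c: "y ^ 2 = x * (x ^ 2 + A * x + t)" by (simp add: mid_curve_iff)
    from v have "x * (v * x) = x * (x ^ 2 + A * x + t)"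
      unfolding c by (simp add: power2_eq_square algebra_simps)
    with x have "v * x = x ^ 2 + A * x + t"
      by simp
    then have vx: "x ^ 2 + t = (v - A) * x"
      by (simp add: algebra_simps)
    have vX: "v = - 4 * p"
      unfolding p_def using quarter by Groebner_Basis.algebra
    \<comment> \<open>The square of t - x^2 is the square of t + x^2 minus 4 t x^2.\<close>
    have disc: "(t - x ^ 2) ^ 2 = ((v - A) ^ 2 - 4 * t) * x ^ 2"
      using vx by Groebner_Basis.algebra
    \<comment> \<open>From A = 4t + 1/4 one gets A^2 - 4t = (4t - 1/4)^2, and 1/4 - 4t = 4T.\<close>
    have A2: "A ^ 2 - 4 * t = 16 * T ^ 2"
      using sum unfolding A_def by Groebner_Basis.algebra
    have A8: "8 * A = 16 * (quarter - 2 * T)"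
      unfolding A_def quarter_def by (simp add: algebra_simps)
    have "(v - A) ^ 2 - 4 * t = 16 * p ^ 2 + 8 * A * p + (A ^ 2 - 4 * t)"
      unfolding vX by (simp add: algebra_simps power2_eq_square)
    also have "\<dots> = 16 * (p ^ 2 + (quarter - 2 * T) * p + T ^ 2)"
      unfolding A2 A8 by (simp add: algebra_simps)
    finally have D: "(v - A) ^ 2 - 4 * t = 16 * (p ^ 2 + (quarter - 2 * T) * p + T ^ 2)" .
    have "x ^ 4 * q ^ 2 = (q * x ^ 2) ^ 2" by (simp add: algebra_simps eval_nat_numeral)
    also have "\<dots> = k ^ 2 * (v * x ^ 2) * (t - x ^ 2) ^ 2"
      unfolding q v by (simp add: algebra_simps eval_nat_numeral)
    also have "\<dots> = x ^ 4 * (- 4 * k ^ 2 * p * (16 * (p ^ 2 + (quarter - 2 * T) * p + T ^ 2)))"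
      unfolding disc D unfolding vX by (simp add: algebra_simps eval_nat_numeral)
    finally have "q ^ 2 = - 4 * k ^ 2 * p * (16 * (p ^ 2 + (quarter - 2 * T) * p + T ^ 2))"
      by (rule mult_left_cancel[THEN iffD1, rotated]) (use x in simp)
    \<comment> \<open>The factor -4 from v = -4p and the 16 of the discriminant combine to -64 k^2 =
      1.\<close>
    also have "\<dots> = - (64 * k ^ 2) * (p * (p ^ 2 + (quarter - 2 * T) * p + T ^ 2))"
      by (simp add: algebra_simps)
    finally have q2: "q ^ 2 = p * (p ^ 2 + (quarter - 2 * T) * p + T ^ 2)"
      unfolding k by simp
    have "Affine (p - T) (q - half * p) \<in> points (tate T)"
    proof (rule tate_curveI)
      have "(q - half * p + half * (p - T + T)) ^ 2 = q ^ 2" by simp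
      also have "q ^ 2 = (p - T + T) * ((p - T) ^ 2 + quarter * (p - T + T))"
        unfolding q2 by (simp add: algebra_simps power2_eq_square)
      finally show "(q - half * p + half * (p - T + T)) ^ 2 = (p - T + T) * ((p - T) ^ 2 + quarter * (p - T + T))" .
    qed
    then show ?thesis
      using Affine x by (simp add: p_def q_def v_def mult.assoc)
  qed (simp add: Affine points_def)
qed (simp add: points_def)

end

section \<open>Both maps are morphisms: charts by forms\<close>

text \<open>Separates the correctness of a triple wherever it does not vanish from its nonvanishing
  at a given point, so that each triple is verified once and the points of the curve are then
  distributed among the triples.\<close>

definition local_chart ::
  "'k::field weierstrass \<Rightarrow> ('k point \<Rightarrow> 'k point) \<Rightarrow> ('k \<Rightarrow> 'k \<Rightarrow> 'k \<Rightarrow> 'k) \<Rightarrow>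
     ('k \<Rightarrow> 'k \<Rightarrow> 'k \<Rightarrow> 'k) \<Rightarrow> ('k \<Rightarrow> 'k \<Rightarrow> 'k \<Rightarrow> 'k) \<Rightarrow> bool" where
  "local_chart E \<phi> A B C \<longleftrightarrow> (\<exists>d. is_form d A \<and> is_form d B \<and> is_form d C) \<and>
     (\<forall>Q\<in>points E. (form_val A Q, form_val B Q, form_val C Q) \<noteq> (0, 0, 0) \<longrightarrow>
         proj_eq (form_val A Q, form_val B Q, form_val C Q) (homog_coords (\<phi> Q)))"

lemma local_chartI:
  assumes "is_form d A" "is_form d B" "is_form d C"
    and "(0, 0, 0) \<noteq> (A 0 1 0, B 0 1 0, C 0 1 0) \<Longrightarrow>
      proj_eq (A 0 1 0, B 0 1 0, C 0 1 0) (homog_coords (\<phi> Infinity))"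
    and "\<And>x y. Affine x y \<in> points E \<Longrightarrow> (A x y 1, B x y 1, C x y 1) \<noteq> (0, 0, 0) \<Longrightarrow>
      proj_eq (A x y 1, B x y 1, C x y 1) (homog_coords (\<phi> (Affine x y)))"
  shows "local_chart E \<phi> A B C"
  unfolding local_chart_def
proof (intro conjI ballI impI)
  show "\<exists>d. is_form d A \<and> is_form d B \<and> is_form d C" using assms by blast
  fix Q assume "Q \<in> points E" "(form_val A Q, form_val B Q, form_val C Q) \<noteq> (0, 0, 0)"
  then show "proj_eq (form_val A Q, form_val B Q, form_val C Q) (homog_coords (\<phi> Q))"
    using assms(4,5) by (cases Q) (auto simp del: homog_coords.simps)
qed

lemma curve_morphismI:
  assumes "\<phi> ` points E \<subseteq> points E'"
    and "\<And>P. P \<in> points E \<Longrightarrow> \<exists>A B C. local_chart E \<phi> A B C \<and>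
      (form_val A P, form_val B P, form_val C P) \<noteq> (0, 0, 0)"
  shows "curve_morphism E E' \<phi>"
  using assms unfolding curve_morphism_iff local_chart_def by blast

text \<open>The degree equation is a separate premise, so that the rules apply to a numeral degree
  and leave arithmetic to the simplifier.\<close>

lemma is_form_mult':
  "is_form d F \<Longrightarrow> is_form e G \<Longrightarrow> n = d + e \<Longrightarrow> is_form n (\<lambda>x y z. F x y z * G x y z)"
  using is_form_mult by blast

lemma is_form_power':
  "is_form d F \<Longrightarrow> n = m * d \<Longrightarrow> is_form n (\<lambda>x y z. F x y z ^ m)"
  using is_form_power by blast

lemmas is_form_intros = is_form_X is_form_Y is_form_Z is_form_const is_form_add is_form_diff
  is_form_uminus is_form_mult' is_form_power'

context tate_pair
begin

lemma isog1_affine: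
  assumes "s = x + t" "s \<noteq> 0" "w = y + half * s"
  shows "isog1 (Affine x y) = Affine (x ^ 2 / s) (- (w * x * (s + t) / s ^ 2))"
proof -
  have "isog1 (Affine x y) = Affine (x ^ 2 / s) (- (y + half * s) * x * (x + 2 * t) / s ^ 2)"
    using assms(1,2) by simp
  also have "x + 2 * t = s + t" by (simp add: assms(1))
  also have "- (y + half * s) * x * (s + t) / s ^ 2 = - (w * x * (s + t) / s ^ 2)"
    by (simp only: assms(3) mult_minus_left minus_divide_left)
  finally show ?thesis .
qed

lemma tate_kernel_point: "Affine x y \<in> points (tate t) \<Longrightarrow> x + t = 0 \<Longrightarrow> x = - t \<and> y = 0"
  by (simp add: tate_curve_iff add_eq_0_iff2)

text \<open>
  The charts at the two points of the kernel arise from the affine one by cancelling common zeros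
  with the equation \<open>x\<^sup>2 s = y z (y + s)\<close> of the curve, where \<open>s = x + t z\<close>.
\<close>

lemma isog1_chart_affine:
  "local_chart (tate t) isog1
    (\<lambda>x y z. x ^ 2 * (x + t * z))
    (\<lambda>x y z. - ((y + half * (x + t * z)) * x * (x + t * z + t * z)))
    (\<lambda>x y z. (x + t * z) ^ 2 * z)"
  (is "local_chart _ _ ?A ?B ?C")
proof (rule local_chartI)
  show "is_form 3 ?A" "is_form 3 ?B" "is_form 3 ?C"
    by (rule is_form_intros | simp)+
  fix x y assume P: "Affine x y \<in> points (tate t)" and nz: "(?A x y 1, ?B x y 1, ?C x y 1) \<noteq> (0, 0, 0)"
  define s where "s = x + t"
  define w where "w = y + half * s"
  have vals: "?A x y 1 = x ^ 2 * s" "?B x y 1 = - (w * x * (s + t))" "?C x y 1 = s ^ 2"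
    by (simp_all add: s_def w_def)
  show "proj_eq (?A x y 1, ?B x y 1, ?C x y 1) (homog_coords (isog1 (Affine x y)))"
  proof (cases "s = 0")
    case True
    with P have "x = - t" "y = 0" using tate_kernel_point[of x y] by (auto simp: s_def)
    with True nz show ?thesis unfolding vals by (simp add: w_def)
  next
    case False
    show ?thesis
      unfolding vals isog1_affine[OF s_def False w_def]
      by (rule proj_eq_affineI) (use False in \<open>simp_all add: power2_eq_square\<close>)
  qed
qed simp

text \<open>The affine triple times x/z, with x^2 s replaced by y z (y + s). At
  \<open>Infinity\<close> it takes the value (0, -1, 0).\<close>

lemma isog1_chart_infinity:
  "local_chart (tate t) isog1
    (\<lambda>x y z. x * (y * (y + (x + t * z))))
    (\<lambda>x y z. - ((y + half * (x + t * z)) * (y * (y + (x + t * z)) + t * x ^ 2)))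
    (\<lambda>x y z. (x + t * z) ^ 2 * x)"
  (is "local_chart _ _ ?A ?B ?C")
proof (rule local_chartI)
  show "is_form 3 ?A" "is_form 3 ?B" "is_form 3 ?C"
    by (rule is_form_intros | simp)+
  show "proj_eq (?A 0 1 0, ?B 0 1 0, ?C 0 1 0) (homog_coords (isog1 Infinity))"
    unfolding isog1.simps by (rule proj_eq_InfinityI) simp_all
  fix x y assume P: "Affine x y \<in> points (tate t)" and nz: "(?A x y 1, ?B x y 1, ?C x y 1) \<noteq> (0, 0, 0)"
  define s where "s = x + t"
  define w where "w = y + half * s"
  have c: "y * (y + s) = x ^ 2 * s"
    using P by (simp add: tate_curve_iff s_def)
  have vals: "?A x y 1 = x * (x ^ 2 * s)" "?B x y 1 = - (w * (x ^ 2 * (s + t)))"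
    "?C x y 1 = s ^ 2 * x"
    using c by (simp_all add: s_def w_def algebra_simps)
  show "proj_eq (?A x y 1, ?B x y 1, ?C x y 1) (homog_coords (isog1 (Affine x y)))"
  proof (cases "s = 0")
    case True
    with P have "x = - t" "y = 0" using tate_kernel_point[of x y] by (auto simp: s_def)
    with True nz show ?thesis unfolding vals by (simp add: w_def)
  next
    case False
    from nz have "x \<noteq> 0" unfolding vals by auto
    with False show ?thesis
      unfolding vals isog1_affine[OF s_def False w_def]
      by (intro proj_eq_affineI) (simp_all add: power2_eq_square field_simps)
  qed
qed

text \<open>The affine triple times z (y + s)/s. The curve equation gives y z (y + s)/s = x^2, which
  clears the denominator in the middle form; its value at (-t, 0) is t^4.\<close>

lemma isog1_chart_kernel:
  "local_chart (tate t) isog1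
    (\<lambda>x y z. x ^ 2 * z * (y + (x + t * z)))
    (\<lambda>x y z. - ((x ^ 2 + half * z * (y + (x + t * z))) * x * (x + t * z + t * z)))
    (\<lambda>x y z. (x + t * z) * z ^ 2 * (y + (x + t * z)))"
  (is "local_chart _ _ ?A ?B ?C")
proof (rule local_chartI)
  show "is_form 4 ?A" "is_form 4 ?B" "is_form 4 ?C"
    by (rule is_form_intros | simp)+
  fix x y assume P: "Affine x y \<in> points (tate t)" and nz: "(?A x y 1, ?B x y 1, ?C x y 1) \<noteq> (0, 0, 0)"
  define s where "s = x + t"
  define w where "w = y + half * s"
  have c: "y * (y + s) = x ^ 2 * s"
    using P by (simp add: tate_curve_iff s_def)
  have vals: "?A x y 1 = x ^ 2 * (y + s)" "?B x y 1 = - ((x ^ 2 + half * (y + s)) * x * (s + t))"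
    "?C x y 1 = s * (y + s)"
    by (simp_all add: s_def)
  show "proj_eq (?A x y 1, ?B x y 1, ?C x y 1) (homog_coords (isog1 (Affine x y)))"
  proof (cases "s = 0")
    case True
    with P have xy: "x = - t" "y = 0" using tate_kernel_point[of x y] by (auto simp: s_def)
    with True have inf: "isog1 (Affine x y) = Infinity" by simp
    show ?thesis unfolding vals inf using True xy t by (intro proj_eq_InfinityI) simp_all
  next
    case False
    have ys: "y + s \<noteq> 0"
    proof
      assume ys: "y + s = 0"
      with c False have "x = 0" by simp
      with ys nz show False unfolding vals by simp
    qed
    have "(x ^ 2 + half * (y + s)) * s = (y + s) * w"
      using c w_def by Groebner_Basis.algebra
    then have "x ^ 2 + half * (y + s) = (y + s) * w / s"
      using False by (simp add: eq_divide_eq)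
    then show ?thesis
      using False ys
      unfolding vals isog1_affine[OF s_def False w_def]
      by (intro proj_eq_affineI) (simp_all add: power2_eq_square)
  qed
qed simp

lemma curve_morphism_isog1: "curve_morphism (tate t) mid isog1"
proof (rule curve_morphismI)
  show "isog1 ` points (tate t) \<subseteq> points mid" using isog1_maps by auto
  fix P assume P: "P \<in> points (tate t)"
  consider "P = Infinity" | x y where "P = Affine x y" "x + t = 0" | x y where "P = Affine x y" "x + t \<noteq> 0"
    by (cases P) auto
  then show "\<exists>A B C. local_chart (tate t) isog1 A B C \<and> (form_val A P, form_val B P, form_val C P) \<noteq> (0, 0, 0)"
  proof cases
    case 1
    show ?thesis by (intro exI conjI, rule isog1_chart_infinity) (simp add: 1)
  next
    case 2
    with P tate_kernel_point[of x y] have xy: "x = - t" "y = 0" by auto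
    show ?thesis by (intro exI conjI, rule isog1_chart_kernel) (simp add: 2(1) xy t)
  next
    case 3
    show ?thesis by (intro exI conjI, rule isog1_chart_affine) (simp add: 3)
  qed
qed

lemma isog2_affine:
  assumes "x \<noteq> 0" "p = - quarter * y ^ 2 / x ^ 2" "q = k * y * (t - x ^ 2) / x ^ 2"
  shows "isog2 (Affine x y) = Affine (p - T) (q - half * p)"
  using assms by simp

text \<open>
  Likewise with the equation \<open>y\<^sup>2 z = x r\<close>, where \<open>r = x\<^sup>2 + A x z + t z\<^sup>2\<close>.
\<close>

lemma isog2_chart_affine:
  "local_chart mid isog2
    (\<lambda>x y z. - (quarter * y ^ 2 * z) - T * (x ^ 2 * z))
    (\<lambda>x y z. k * y * (t * z ^ 2 - x ^ 2) - half * (- (quarter * y ^ 2 * z)))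
    (\<lambda>x y z. x ^ 2 * z)"
  (is "local_chart _ _ ?A ?B ?C")
proof (rule local_chartI)
  show "is_form 3 ?A" "is_form 3 ?B" "is_form 3 ?C"
    by (rule is_form_intros | simp)+
  fix x y assume P: "Affine x y \<in> points mid" and nz: "(?A x y 1, ?B x y 1, ?C x y 1) \<noteq> (0, 0, 0)"
  show "proj_eq (?A x y 1, ?B x y 1, ?C x y 1) (homog_coords (isog2 (Affine x y)))"
  proof (cases "x = 0")
    case True
    with P have "y = 0" by (simp add: mid_curve_iff)
    with True nz show ?thesis by simp
  next
    case False
    show ?thesis
      unfolding isog2_affine[OF False refl refl]
      by (rule proj_eq_affineI) (use False in \<open>simp_all add: field_simps\<close>)
  qed
qed simp

text \<open>The affine triple times y z/x, with y^2 z/x replaced by r. At the origin the middle form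
  is k t^2.\<close>

lemma isog2_chart_kernel:
  "local_chart mid isog2
    (\<lambda>x y z. - (quarter * y * z * (x ^ 2 + A * x * z + t * z ^ 2)) - T * (x * y * z ^ 2))
    (\<lambda>x y z. k * (t * z ^ 2 - x ^ 2) * (x ^ 2 + A * x * z + t * z ^ 2) -
       half * (- (quarter * y * z * (x ^ 2 + A * x * z + t * z ^ 2))))
    (\<lambda>x y z. x * y * z ^ 2)"
  (is "local_chart _ _ ?A ?B ?C")
proof (rule local_chartI)
  show "is_form 4 ?A" "is_form 4 ?B" "is_form 4 ?C"
    by (rule is_form_intros | simp)+
  fix x y assume P: "Affine x y \<in> points mid" and nz: "(?A x y 1, ?B x y 1, ?C x y 1) \<noteq> (0, 0, 0)"
  define r where "r = x ^ 2 + A * x + t"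
  have c: "y ^ 2 = x * r"
    using P by (simp add: mid_curve_iff r_def)
  have vals: "(?A x y 1, ?B x y 1, ?C x y 1) = (- (quarter * y * r) - T * (x * y),
      k * (t - x ^ 2) * r - half * (- (quarter * y * r)), x * y)"
    by (simp_all add: r_def)
  show "proj_eq (?A x y 1, ?B x y 1, ?C x y 1) (homog_coords (isog2 (Affine x y)))"
  proof (cases "x = 0")
    case True
    with c have y: "y = 0" by simp
    with True have inf: "isog2 (Affine x y) = Infinity" by simp
    show ?thesis unfolding vals inf using True y t k_nonzero by (intro proj_eq_InfinityI) (simp_all add: r_def)
  next
    case False
    have y: "y \<noteq> 0"
    proof
      assume y: "y = 0"
      with c False have "r = 0" by simp
      with y nz show False unfolding vals by simp
    qed
    have r: "r = y ^ 2 / x" using c False by simp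
    show ?thesis
      unfolding vals isog2_affine[OF False refl refl] r
      by (rule proj_eq_affineI) (use False y in \<open>simp_all add: field_simps eval_nat_numeral\<close>)
  qed
qed simp

text \<open>The affine triple times y^3/x^2, using y^2 z/x = r. The quotient r^2/z that arises is
  the form y^2 (x + A z) + t z r. At \<open>Infinity\<close> the middle form is -k.\<close>

lemma isog2_chart_infinity:
  "local_chart mid isog2
    (\<lambda>x y z. - (quarter * y * (y ^ 2 * (x + A * z) + t * z * (x ^ 2 + A * x * z + t * z ^ 2))) - T * (z * y ^ 3))
    (\<lambda>x y z. k * (t * (x ^ 2 + A * x * z + t * z ^ 2) ^ 2 - y ^ 4) -
       half * (- (quarter * y * (y ^ 2 * (x + A * z) + t * z * (x ^ 2 + A * x * z + t * z ^ 2)))))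
    (\<lambda>x y z. z * y ^ 3)"
  (is "local_chart _ _ ?A ?B ?C")
proof (rule local_chartI)
  show "is_form 4 ?A" "is_form 4 ?B" "is_form 4 ?C"
    by (rule is_form_intros | simp)+
  show "proj_eq (?A 0 1 0, ?B 0 1 0, ?C 0 1 0) (homog_coords (isog2 Infinity))"
    unfolding isog2.simps by (rule proj_eq_InfinityI) (simp_all add: k_nonzero)
  fix x y assume P: "Affine x y \<in> points mid" and nz: "(?A x y 1, ?B x y 1, ?C x y 1) \<noteq> (0, 0, 0)"
  define r where "r = x ^ 2 + A * x + t"
  have c: "y ^ 2 = x * r"
    using P by (simp add: mid_curve_iff r_def)
  have "y ^ 2 * (x + A) + t * r = r ^ 2"
    using c r_def by Groebner_Basis.algebra
  then have vals: "(?A x y 1, ?B x y 1, ?C x y 1) = (- (quarter * y * r ^ 2) - T * y ^ 3,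
      k * (t * r ^ 2 - y ^ 4) - half * (- (quarter * y * r ^ 2)), y ^ 3)"
    by (simp_all add: r_def)
  show "proj_eq (?A x y 1, ?B x y 1, ?C x y 1) (homog_coords (isog2 (Affine x y)))"
  proof (cases "x = 0")
    case True
    with c have y: "y = 0" by simp
    with True have inf: "isog2 (Affine x y) = Infinity" by simp
    show ?thesis unfolding vals inf using True y t k_nonzero by (intro proj_eq_InfinityI) (simp_all add: r_def)
  next
    case False
    have y: "y \<noteq> 0"
    proof
      assume y: "y = 0"
      with c False have "r = 0" by simp
      with y nz show False unfolding vals by simp
    qed
    have r: "r = y ^ 2 / x" using c False by simp
    show ?thesis
      unfolding vals isog2_affine[OF False refl refl] r
      by (rule proj_eq_affineI) (use False y in \<open>simp_all add: field_simps eval_nat_numeral\<close>)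
  qed
qed

lemma curve_morphism_isog2: "curve_morphism mid (tate T) isog2"
proof (rule curve_morphismI)
  show "isog2 ` points mid \<subseteq> points (tate T)" using isog2_maps by auto
  fix P assume P: "P \<in> points mid"
  consider "P = Infinity" | y where "P = Affine 0 y" | x y where "P = Affine x y" "x \<noteq> 0"
    by (cases P) auto
  then show "\<exists>A B C. local_chart mid isog2 A B C \<and> (form_val A P, form_val B P, form_val C P) \<noteq> (0, 0, 0)"
  proof cases
    case 1
    show ?thesis by (intro exI conjI, rule isog2_chart_infinity) (simp add: 1 k_nonzero)
  next
    case 2
    with P have y: "y = 0" by (simp add: mid_curve_iff)
    show ?thesis by (intro exI conjI, rule isog2_chart_kernel) (simp add: 2 y t k_nonzero)
  next
    case 3
    show ?thesis by (intro exI conjI, rule isog2_chart_affine) (simp add: 3)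
  qed
qed

section \<open>Fibres of the two maps\<close>

lemma finite_fibre_isog1: "finite {Q \<in> points (tate t). isog1 Q = P}"
proof (cases P)
  case Infinity
  have "{Q \<in> points (tate t). isog1 Q = P} \<subseteq> {Q \<in> points (tate t). Q = Infinity \<or> x_coord Q \<in> {- t}}"
  proof
    fix Q assume "Q \<in> {Q \<in> points (tate t). isog1 Q = P}"
    then show "Q \<in> {Q \<in> points (tate t). Q = Infinity \<or> x_coord Q \<in> {- t}}"
      by (cases Q) (auto simp: Infinity add_eq_0_iff2 split: if_splits)
  qed
  then show ?thesis
    by (rule finite_subset) (intro finite_points_over, simp)
next
  case (Affine p q)
  define S where "S = {x. 1 * x ^ 2 + (- p) * x + (- (p * t)) = 0}"
  have "finite S"
    unfolding S_def by (rule finite_quadratic_roots) simp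
  have "{Q \<in> points (tate t). isog1 Q = P} \<subseteq> {Q \<in> points (tate t). Q = Infinity \<or> x_coord Q \<in> S}"
  proof
    fix Q assume Q: "Q \<in> {Q \<in> points (tate t). isog1 Q = P}"
    then obtain x y where xy: "Q = Affine x y" by (cases Q) (auto simp: Affine)
    with Q have "x + t \<noteq> 0" "x ^ 2 / (x + t) = p" by (auto simp: Affine split: if_splits)
    then have "x ^ 2 = p * (x + t)" by (simp add: divide_eq_eq)
    then have "x \<in> S" by (simp add: S_def algebra_simps)
    with Q xy show "Q \<in> {Q \<in> points (tate t). Q = Infinity \<or> x_coord Q \<in> S}" by simp
  qed
  then show ?thesis
    by (rule finite_subset) (rule finite_points_over, rule \<open>finite S\<close>)
qed

lemma finite_fibre_isog2: "finite {Q \<in> points mid. isog2 Q = P}"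
proof (cases P)
  case Infinity
  have "{Q \<in> points mid. isog2 Q = P} \<subseteq> {Q \<in> points mid. Q = Infinity \<or> x_coord Q \<in> {0}}"
  proof
    fix Q assume "Q \<in> {Q \<in> points mid. isog2 Q = P}"
    then show "Q \<in> {Q \<in> points mid. Q = Infinity \<or> x_coord Q \<in> {0}}"
      by (cases Q) (auto simp: Infinity split: if_splits)
  qed
  then show ?thesis
    by (rule finite_subset) (intro finite_points_over, simp)
next
  case (Affine p q)
  define S where "S = {x. quarter * x ^ 2 + (quarter * A + (p + T)) * x + quarter * t = 0}"
  have "finite S"
    unfolding S_def by (rule finite_quadratic_roots) (simp add: quarter_nonzero)
  have "{Q \<in> points mid. isog2 Q = P} \<subseteq> {Q \<in> points mid. Q = Infinity \<or> x_coord Q \<in> S}"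
  proof
    fix Q assume Q: "Q \<in> {Q \<in> points mid. isog2 Q = P}"
    then obtain x y where xy: "Q = Affine x y" by (cases Q) (auto simp: Affine)
    with Q have x: "x \<noteq> 0" and p: "- quarter * y ^ 2 / x ^ 2 - T = p" by (auto simp: Affine split: if_splits)
    from Q xy have c: "y ^ 2 = x * (x ^ 2 + A * x + t)" by (simp add: mid_curve_iff)
    from p have "- quarter * y ^ 2 / x ^ 2 = p + T" by (simp add: algebra_simps)
    then have "- quarter * y ^ 2 / x ^ 2 * x ^ 2 = (p + T) * x ^ 2" by (simp only:)
    with x have "- quarter * y ^ 2 = (p + T) * x ^ 2" by simp
    then have "x * (quarter * x ^ 2 + (quarter * A + (p + T)) * x + quarter * t) = 0"
      unfolding c by Groebner_Basis.algebra
    with x have "x \<in> S" by (simp add: S_def)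
    with Q xy show "Q \<in> {Q \<in> points mid. Q = Infinity \<or> x_coord Q \<in> S}" by simp
  qed
  then show ?thesis
    by (rule finite_subset) (rule finite_points_over, rule \<open>finite S\<close>)
qed

text \<open>The root \<open>s\<close> fixes the abscissa s - t of a preimage. Put e = 2s - (p + 2t),
  a square root of the discriminant p (p + 4t) and hence nonzero. As s e = s^2 - t^2, the formula
  for the ordinate reads q = -w e/s, which is solved for w.\<close>

lemma isog1_preimage:
  assumes R: "Affine p q \<in> points mid" and s: "s ^ 2 = (p + 2 * t) * s - t ^ 2"
    and p: "p \<noteq> 0" "p + 4 * t \<noteq> 0"
  shows "\<exists>y. Affine (s - t) y \<in> points (tate t) \<and> isog1 (Affine (s - t) y) = Affine p q"
proof -
  define e where "e = 2 * s - (p + 2 * t)"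
  have e2: "e ^ 2 = p * (p + 4 * t)"
    unfolding e_def using s by Groebner_Basis.algebra
  have e: "e \<noteq> 0" using e2 p by auto
  have s0: "s \<noteq> 0" using s t by auto
  have se: "s * e = (s - t) * (s + t)" and sp: "(s - t) ^ 2 = p * s"
    unfolding e_def using s by Groebner_Basis.algebra+
  define w where "w = - q * s / e"
  define y where "y = w - half * s"
  have w: "w * e = - q * s" using e by (simp add: w_def)
  have wy: "w = y + half * s" by (simp add: y_def)
  have q: "q ^ 2 = e ^ 2 * (p + quarter)"
  proof -
    have "p ^ 2 + A * p + t = (p + 4 * t) * (p + quarter)"
      using quarter unfolding A_def quarter_def by Groebner_Basis.algebra
    with R show ?thesis by (simp add: mid_curve_iff e2 mult.assoc)
  qed
  have "e ^ 2 * w ^ 2 = (w * e) ^ 2" by (simp add: power_mult_distrib)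
  also have "\<dots> = q ^ 2 * s ^ 2"
    unfolding w by (simp add: power_mult_distrib)
  also have "\<dots> = e ^ 2 * (s * (p * s + quarter * s))"
    unfolding q by (simp add: power2_eq_square algebra_simps)
  finally have "w ^ 2 = s * (p * s + quarter * s)"
    by (rule mult_left_cancel[THEN iffD1, rotated]) (use e in simp)
  then have "w ^ 2 = s * ((s - t) ^ 2 + quarter * s)" by (simp only: sp)
  then have "Affine (s - t) y \<in> points (tate t)"
    by (intro tate_curveI) (simp add: wy)
  moreover have "isog1 (Affine (s - t) y) = Affine p q"
  proof -
    have "w * (s - t) * (s + t) = - q * s ^ 2"
      using w se by Groebner_Basis.algebra
    then have "- (w * (s - t) * (s + t) / s ^ 2) = q" using s0 by simp
    moreover have "(s - t) ^ 2 / s = p" using sp s0 by simp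
    ultimately show ?thesis
      by (subst isog1_affine[OF _ s0 wy]) simp_all
  qed
  ultimately show ?thesis by blast
qed

text \<open>As before with e a square root of the discriminant: here u e = u^2 - t, so q = -k y e/u.
  Solving for y uses 64 k = -1/k.\<close>

lemma isog2_preimage:
  assumes R: "Affine p' q' \<in> points (tate T)" and u: "u ^ 2 = (- 4 * (p' + T) - A) * u - t"
    and D: "(- 4 * (p' + T) - A) ^ 2 - 4 * t \<noteq> 0"
  shows "\<exists>y. Affine u y \<in> points mid \<and> isog2 (Affine u y) = Affine p' q'"
proof -
  define p where "p = p' + T"
  define q where "q = q' + half * p"
  define e where "e = 2 * u - (- 4 * p - A)"
  have u': "u ^ 2 = (- 4 * p - A) * u - t" using u by (simp add: p_def)
  have e2: "e ^ 2 = (- 4 * p - A) ^ 2 - 4 * t"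
    unfolding e_def using u' by Groebner_Basis.algebra
  have e: "e \<noteq> 0" using e2 D by (auto simp: p_def)
  have u0: "u \<noteq> 0" using u t by auto
  have ue: "t - u ^ 2 = - (u * e)"
    unfolding e_def using u' by Groebner_Basis.algebra
  define y where "y = 64 * k * q * u / e"
  have y: "y * e = 64 * k * q * u" using e by (simp add: y_def)
  have q: "q ^ 2 = p * (p' ^ 2 + quarter * p)"
    using tate_curve_square[OF R] by (simp add: p_def q_def)
  have q16: "16 * q ^ 2 = p * e ^ 2"
  proof -
    have "A ^ 2 - 4 * t = 16 * T ^ 2"
      using sum unfolding A_def by Groebner_Basis.algebra
    moreover have "8 * A = 16 * (quarter - 2 * T)"
      unfolding A_def quarter_def by (simp add: algebra_simps)
    moreover have "p' = p - T" by (simp add: p_def)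
    ultimately show ?thesis using q e2 by Groebner_Basis.algebra
  qed
  have "e ^ 2 * y ^ 2 = (y * e) ^ 2" by (simp add: power_mult_distrib)
  also have "\<dots> = (64 * k ^ 2) * 64 * q ^ 2 * u ^ 2"
    unfolding y by (simp add: power_mult_distrib)
  also have "\<dots> = e ^ 2 * (- 4 * p * u ^ 2)"
    unfolding k using q16 by Groebner_Basis.algebra
  finally have y2: "y ^ 2 = - 4 * p * u ^ 2"
    by (rule mult_left_cancel[THEN iffD1, rotated]) (use e in simp)
  have "y ^ 2 = u * (u ^ 2 + A * u + t)"
    unfolding y2 using u' by Groebner_Basis.algebra
  then have "Affine u y \<in> points mid" by (simp add: mid_curve_iff)
  moreover have "isog2 (Affine u y) = Affine p' q'"
  proof -
    have "- quarter * y ^ 2 / u ^ 2 = (4 * quarter) * p"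
      unfolding y2 using u0 by simp
    then have p: "p = - quarter * y ^ 2 / u ^ 2" by (simp add: quarter)
    have "k * y * (t - u ^ 2) = q * u ^ 2"
      unfolding ue using y k by Groebner_Basis.algebra
    then have "q = k * y * (t - u ^ 2) / u ^ 2" using u0 by simp
    from isog2_affine[OF u0 p this] show ?thesis by (simp add: p_def q_def)
  qed
  ultimately show ?thesis by blast
qed

lemma distinct_quadratic_roots:
  fixes b c :: 'k
  assumes "b ^ 2 - 4 * c \<noteq> 0"
  obtains x x' where "x ^ 2 = b * x - c" "x' ^ 2 = b * x' - c" "x \<noteq> x'"
proof -
  obtain x where x: "x ^ 2 = b * x - c" by (rule quadratic_root_exists)
  have "(b - x) ^ 2 = b * (b - x) - c" using x by Groebner_Basis.algebra
  moreover have "x \<noteq> b - x"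
  proof
    assume "x = b - x"
    then have "b ^ 2 - 4 * c = 0" using x by Groebner_Basis.algebra
    with assms show False by simp
  qed
  ultimately show thesis using x that by blast
qed

text \<open>The generator is s = x + t. Trace and norm are read off from (s - t)^2 = p s, where p is
  the image abscissa.\<close>

lemma double_cover_isog1:
  "double_cover (tate t) mid isog1 (\<lambda>P. x_coord P + t) (\<lambda>P. x_coord P + 2 * t) (\<lambda>P. t ^ 2)"
proof
  show maps: "isog1 ` points (tate t) \<subseteq> points mid" using isog1_maps by auto
  show fin: "finite {Q \<in> points (tate t). isog1 Q = P}" for P by (rule finite_fibre_isog1)
  note lim = filterlim_almost_all_points[OF maps fin]
  have aff: "eventually (\<lambda>P. \<exists>x y. P = Affine x y \<and> x \<notin> {- t} \<and> on_curve (tate t) (Affine x y))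
    (almost_all_points (tate t))"
    by (rule eventually_x_coord) simp
  have nz: "eventually (\<lambda>P. x_coord P + t \<noteq> 0) (almost_all_points (tate t))"
    using aff by eventually_elim (auto simp: add_eq_0_iff2)
  note rats = rational_fun_x_coord[of "tate t"] rational_fun_y_coord[of "tate t"]
  show ratu: "rational_fun (tate t) (\<lambda>P. x_coord P + t)"
    by (intro rational_fun_add rats rational_fun_const)
  show "rational_fun (tate t) (\<lambda>P. x_coord (isog1 P))"
  proof (rule rational_fun_cong)
    show "rational_fun (tate t) (\<lambda>P. x_coord P ^ 2 / (x_coord P + t))"
      by (rule rational_fun_divide[OF _ _ nz]) (intro rational_fun_power rats ratu)+
    show "eventually (\<lambda>P. x_coord P ^ 2 / (x_coord P + t) = x_coord (isog1 P)) (almost_all_points (tate t))"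
      using aff by eventually_elim (auto simp: add_eq_0_iff2)
  qed
  show "rational_fun (tate t) (\<lambda>P. y_coord (isog1 P))"
  proof (rule rational_fun_cong)
    show "rational_fun (tate t) (\<lambda>P. (- (y_coord P + half * (x_coord P + t)) * x_coord P * (x_coord P + 2 * t)) / (x_coord P + t) ^ 2)"
      by (rule rational_fun_divide)
         ((intro rational_fun_mult rational_fun_uminus rational_fun_add rational_fun_power rats rational_fun_const)+,
          use nz in simp)
    show "eventually (\<lambda>P. (- (y_coord P + half * (x_coord P + t)) * x_coord P * (x_coord P + 2 * t)) / (x_coord P + t) ^ 2 =
        y_coord (isog1 P)) (almost_all_points (tate t))"
      using aff by eventually_elim (auto simp: add_eq_0_iff2)
  qed
  show rat_trace: "rational_fun mid (\<lambda>P. x_coord P + 2 * t)"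
    by (intro rational_fun_add rational_fun_x_coord rational_fun_const)
  show "rational_fun mid (\<lambda>P. t ^ 2)" by (rule rational_fun_const)
  have quadratic: "(x_coord P + t) ^ 2 = (x_coord (isog1 P) + 2 * t) * (x_coord P + t) - t ^ 2"
    if "P = Affine x y" "x + t \<noteq> 0" for P x y
  proof -
    have "x ^ 2 / (x + t) * (x + t) = x ^ 2" using that(2) by simp
    then show ?thesis using that by (simp add: algebra_simps power2_eq_square)
  qed
  show "eventually (\<lambda>P. (x_coord P + t) ^ 2 = (x_coord (isog1 P) + 2 * t) * (x_coord P + t) - t ^ 2)
      (almost_all_points (tate t))"
    using aff by eventually_elim (auto simp: add_eq_0_iff2 intro!: quadratic)
  \<comment> \<open>The excluded abscissas are the zeros of p (p + 4t), the discriminant of the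
    quadratic for s.\<close>
  have aff': "eventually (\<lambda>R. \<exists>p q. R = Affine p q \<and> p \<notin> {0, - 4 * t} \<and> on_curve mid (Affine p q))
    (almost_all_points mid)"
    by (rule eventually_x_coord) simp
  show "eventually (\<lambda>R. \<exists>P\<in>points (tate t). \<exists>Q\<in>points (tate t). isog1 P = R \<and> isog1 Q = R \<and>
      x_coord P + t \<noteq> x_coord Q + t) (almost_all_points mid)"
    using aff'
  proof eventually_elim
    case (elim R)
    then obtain p q where R: "R = Affine p q" "p \<noteq> 0" "p + 4 * t \<noteq> 0" "Affine p q \<in> points mid"
      by (auto simp: points_def add_eq_0_iff2)
    have "(p + 2 * t) ^ 2 - 4 * t ^ 2 = p * (p + 4 * t)"
      by (simp add: algebra_simps power2_eq_square)
    with R have "(p + 2 * t) ^ 2 - 4 * t ^ 2 \<noteq> 0" by simp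
    then obtain s s' where s: "s ^ 2 = (p + 2 * t) * s - t ^ 2" "s' ^ 2 = (p + 2 * t) * s' - t ^ 2" "s \<noteq> s'"
      by (rule distinct_quadratic_roots)
    from isog1_preimage[OF R(4) s(1) R(2,3)] isog1_preimage[OF R(4) s(2) R(2,3)]
    obtain y y' where "Affine (s - t) y \<in> points (tate t)" "isog1 (Affine (s - t) y) = R"
      "Affine (s' - t) y' \<in> points (tate t)" "isog1 (Affine (s' - t) y') = R"
      unfolding R(1) by blast
    with s(3) show ?case
      by (intro bexI[of _ "Affine (s - t) y"] bexI[of _ "Affine (s' - t) y'"]) (simp_all del: isog1.simps)
  qed
  show "\<exists>g h. rational_fun mid g \<and> rational_fun mid h \<and>
      eventually (\<lambda>P. x_coord P = g (isog1 P) + h (isog1 P) * (x_coord P + t)) (almost_all_points (tate t))"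
    by (intro exI[of _ "\<lambda>P. - t"] exI[of _ "\<lambda>P. 1"] conjI rational_fun_const) simp
  define D where "D = (\<lambda>P. x_coord P * (x_coord P + 4 * t))"
  have D: "rational_fun mid D"
    unfolding D_def by (intro rational_fun_mult rational_fun_add rational_fun_x_coord rational_fun_const)
  have D_nz: "eventually (\<lambda>P. D P \<noteq> 0) (almost_all_points mid)"
    using aff' by eventually_elim (auto simp: D_def add_eq_0_iff2)
  define G where "G = (\<lambda>P. y_coord P / D P)"
  have G: "rational_fun mid G"
    unfolding G_def by (intro rational_fun_divide[OF _ D D_nz] rational_fun_y_coord)
  show "\<exists>g h. rational_fun mid g \<and> rational_fun mid h \<and>
      eventually (\<lambda>P. y_coord P = g (isog1 P) + h (isog1 P) * (x_coord P + t)) (almost_all_points (tate t))"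
  proof (intro exI conjI)
    \<comment> \<open>The coefficients come from w = -q s/e = -G s e with G = q/e^2 and s e = (p +
      2t) s - 2 t^2, followed by y = w - s/2.\<close>
    show "rational_fun mid (\<lambda>P. 2 * t ^ 2 * G P)"
      by (intro rational_fun_mult rational_fun_const G)
    show "rational_fun mid (\<lambda>P. - half - G P * (x_coord P + 2 * t))"
      by (intro rational_fun_mult rational_fun_diff rational_fun_const G rat_trace)
    show "eventually (\<lambda>P. y_coord P = 2 * t ^ 2 * G (isog1 P) +
        (- half - G (isog1 P) * (x_coord (isog1 P) + 2 * t)) * (x_coord P + t)) (almost_all_points (tate t))"
      using aff eventually_compose_filterlim[OF D_nz lim]
    proof eventually_elim
      case (elim P)
      then obtain x y where P: "P = Affine x y" "x + t \<noteq> 0" by (auto simp: add_eq_0_iff2)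
      define s where "s = x + t"
      define w where "w = y + half * s"
      define p where "p = x_coord (isog1 P)"
      define q where "q = y_coord (isog1 P)"
      define g where "g = G (isog1 P)"
      have s: "s \<noteq> 0" using P by (simp add: s_def)
      note iso = isog1_affine[OF s_def s w_def]
      have p: "p * s = x ^ 2" and q: "q * s ^ 2 = - (w * x * (s + t))"
        using s unfolding p_def q_def P(1) iso by simp_all
      have g: "g * (p * (p + 4 * t)) = q"
        using elim(2) by (simp add: g_def G_def D_def p_def q_def)
      have nz: "p * (p + 4 * t) \<noteq> 0"
        using elim(2) by (simp add: D_def p_def)
      have se: "s * (2 * s - (p + 2 * t)) = x * (s + t)"
        using p s_def by Groebner_Basis.algebra
      have e2: "(2 * s - (p + 2 * t)) ^ 2 = p * (p + 4 * t)"
      proof -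
        have "s ^ 2 = (p + 2 * t) * s - t ^ 2" using p s_def by Groebner_Basis.algebra
        then show ?thesis by Groebner_Basis.algebra
      qed
      have "s ^ 2 * (p * (p + 4 * t) * w) = s ^ 2 * (p * (p + 4 * t) * (- g * (s * (2 * s - (p + 2 * t)))))"
        using q g se e2 by Groebner_Basis.algebra
      then have "p * (p + 4 * t) * w = p * (p + 4 * t) * (- g * (s * (2 * s - (p + 2 * t))))"
        by (rule mult_left_cancel[THEN iffD1, rotated]) (use s in simp)
      then have "w = - g * (s * (2 * s - (p + 2 * t)))"
        by (rule mult_left_cancel[THEN iffD1, rotated]) (use nz in simp)
      moreover have "s * (2 * s - (p + 2 * t)) = (p + 2 * t) * s - 2 * t ^ 2"
        using p s_def by Groebner_Basis.algebra
      ultimately have "y = 2 * t ^ 2 * g + (- half - g * (p + 2 * t)) * s"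
        using w_def by Groebner_Basis.algebra
      then show ?case by (simp add: P(1) s_def g_def p_def)
    qed
  qed
qed


text \<open>The generator is x. Dividing the curve equation by x gives x^2 + A x + t = v x with v =
  y^2/x^2, which is -4 times the translated image abscissa.\<close>

lemma double_cover_isog2:
  "double_cover mid (tate T) isog2 x_coord (\<lambda>P. - 4 * (x_coord P + T) - A) (\<lambda>P. t)"
proof
  show maps: "isog2 ` points mid \<subseteq> points (tate T)" using isog2_maps by auto
  show fin: "finite {Q \<in> points mid. isog2 Q = P}" for P by (rule finite_fibre_isog2)
  note lim = filterlim_almost_all_points[OF maps fin]
  have aff: "eventually (\<lambda>P. \<exists>x y. P = Affine x y \<and> x \<notin> {0} \<and> on_curve mid (Affine x y))
    (almost_all_points mid)"
    by (rule eventually_x_coord) simp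
  have nz: "eventually (\<lambda>P. x_coord P ^ 2 \<noteq> 0) (almost_all_points mid)"
    using aff by eventually_elim auto
  note rats = rational_fun_x_coord[of mid] rational_fun_y_coord[of mid]
  show "rational_fun mid x_coord" by (rule rats)
  have rat_x2: "rational_fun mid (\<lambda>P. - quarter * y_coord P ^ 2 / x_coord P ^ 2)"
    by (rule rational_fun_divide[OF _ _ nz]) (intro rational_fun_mult rational_fun_const rational_fun_power rats)+
  show "rational_fun mid (\<lambda>P. x_coord (isog2 P))"
  proof (rule rational_fun_cong)
    show "rational_fun mid (\<lambda>P. - quarter * y_coord P ^ 2 / x_coord P ^ 2 - T)"
      by (intro rational_fun_diff rat_x2 rational_fun_const)
    show "eventually (\<lambda>P. - quarter * y_coord P ^ 2 / x_coord P ^ 2 - T = x_coord (isog2 P)) (almost_all_points mid)"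
      using aff by eventually_elim auto
  qed
  show "rational_fun mid (\<lambda>P. y_coord (isog2 P))"
  proof (rule rational_fun_cong)
    show "rational_fun mid (\<lambda>P. (k * y_coord P * (t - x_coord P ^ 2)) / x_coord P ^ 2 -
        half * (- quarter * y_coord P ^ 2 / x_coord P ^ 2))"
      by (intro rational_fun_diff rational_fun_mult[OF rational_fun_const rat_x2] rational_fun_divide[OF _ _ nz]
          rational_fun_mult rational_fun_power rats rational_fun_const)
    show "eventually (\<lambda>P. (k * y_coord P * (t - x_coord P ^ 2)) / x_coord P ^ 2 -
        half * (- quarter * y_coord P ^ 2 / x_coord P ^ 2) = y_coord (isog2 P)) (almost_all_points mid)"
      using aff by eventually_elim auto
  qed
  show rat_trace: "rational_fun (tate T) (\<lambda>P. - 4 * (x_coord P + T) - A)"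
    by (intro rational_fun_diff rational_fun_mult rational_fun_add rational_fun_x_coord rational_fun_const)
  show "rational_fun (tate T) (\<lambda>P. t)" by (rule rational_fun_const)
  have quadratic: "x ^ 2 = (- 4 * (x_coord (isog2 (Affine x y)) + T) - A) * x - t"
    if "Affine x y \<in> points mid" "x \<noteq> 0" for x y
  proof -
    define p where "p = - quarter * y ^ 2 / x ^ 2"
    have p: "p * x ^ 2 = - quarter * y ^ 2" using that(2) by (simp add: p_def)
    have c: "y ^ 2 = x * (x ^ 2 + A * x + t)" using that(1) by (simp add: mid_curve_iff)
    have "x * x ^ 2 = x * ((- 4 * p - A) * x - t)"
      using p c quarter by Groebner_Basis.algebra
    then have "x ^ 2 = (- 4 * p - A) * x - t"
      by (rule mult_left_cancel[THEN iffD1, rotated]) (use that in simp)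
    moreover have "x_coord (isog2 (Affine x y)) + T = p" using that(2) by (simp add: p_def)
    ultimately show ?thesis by (simp only:)
  qed
  show "eventually (\<lambda>P. x_coord P ^ 2 = (- 4 * (x_coord (isog2 P) + T) - A) * x_coord P - t)
      (almost_all_points mid)"
    using aff
  proof eventually_elim
    case (elim P)
    then obtain x y where P: "P = Affine x y" "x \<noteq> 0" "Affine x y \<in> points mid" by (auto simp: points_def)
    show ?case
      using quadratic[OF P(3,2)] unfolding P(1) by (simp del: isog2.simps)
  qed
  define D where "D = (\<lambda>P. (- 4 * (x_coord P + T) - A) ^ 2 - 4 * t)"
  have D: "rational_fun (tate T) D"
    unfolding D_def by (intro rational_fun_diff rational_fun_mult rational_fun_power rat_trace rational_fun_const)
  have fin_D: "finite {x. (- 4 * (x + T) - A) ^ 2 - 4 * t = 0}"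
  proof -
    have "{x. (- 4 * (x + T) - A) ^ 2 - 4 * t = 0} =
        {x. 16 * x ^ 2 + 8 * (4 * T + A) * x + ((4 * T + A) ^ 2 - 4 * t) = 0}"
      by (simp add: algebra_simps power2_eq_square)
    then show ?thesis
      by (simp only:) (rule finite_quadratic_roots, simp)
  qed
  have aff': "eventually (\<lambda>R. \<exists>p q. R = Affine p q \<and> p \<notin> {x. (- 4 * (x + T) - A) ^ 2 - 4 * t = 0} \<and>
      on_curve (tate T) (Affine p q)) (almost_all_points (tate T))"
    by (rule eventually_x_coord[OF fin_D])
  have D_nz: "eventually (\<lambda>P. D P \<noteq> 0) (almost_all_points (tate T))"
    using aff' by eventually_elim (auto simp: D_def)
  show "eventually (\<lambda>R. \<exists>P\<in>points mid. \<exists>Q\<in>points mid. isog2 P = R \<and> isog2 Q = R \<and>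
      x_coord P \<noteq> x_coord Q) (almost_all_points (tate T))"
    using aff'
  proof eventually_elim
    case (elim R)
    then obtain p q where R: "R = Affine p q" "(- 4 * (p + T) - A) ^ 2 - 4 * t \<noteq> 0" "Affine p q \<in> points (tate T)"
      unfolding points_def by blast
    from R(2) obtain u u' where u: "u ^ 2 = (- 4 * (p + T) - A) * u - t" "u' ^ 2 = (- 4 * (p + T) - A) * u' - t" "u \<noteq> u'"
      by (rule distinct_quadratic_roots)
    from isog2_preimage[OF R(3) u(1) R(2)] isog2_preimage[OF R(3) u(2) R(2)]
    obtain y y' where "Affine u y \<in> points mid" "isog2 (Affine u y) = R"
      "Affine u' y' \<in> points mid" "isog2 (Affine u' y') = R"
      unfolding R(1) by blast
    with u(3) show ?case
      by (intro bexI[of _ "Affine u y"] bexI[of _ "Affine u' y'"]) (simp_all del: isog2.simps)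
  qed
  show "\<exists>g h. rational_fun (tate T) g \<and> rational_fun (tate T) h \<and>
      eventually (\<lambda>P. x_coord P = g (isog2 P) + h (isog2 P) * x_coord P) (almost_all_points mid)"
    by (intro exI[of _ "\<lambda>P. 0"] exI[of _ "\<lambda>P. 1"] conjI rational_fun_const) simp
  define G where "G = (\<lambda>P. 64 * k * (y_coord P + half * (x_coord P + T)) / D P)"
  have G: "rational_fun (tate T) G"
    unfolding G_def
    by (intro rational_fun_divide[OF _ D D_nz] rational_fun_mult rational_fun_add rational_fun_y_coord
        rational_fun_x_coord rational_fun_const)
  show "\<exists>g h. rational_fun (tate T) g \<and> rational_fun (tate T) h \<and>
      eventually (\<lambda>P. y_coord P = g (isog2 P) + h (isog2 P) * x_coord P) (almost_all_points mid)"
  proof (intro exI conjI)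
    \<comment> \<open>Here y = 64 k q x/e = G x e with G = 64 k q/e^2 and x e = sigma x - 2t, where
      sigma is the trace.\<close>
    show "rational_fun (tate T) (\<lambda>P. - 2 * t * G P)"
      by (intro rational_fun_mult rational_fun_const G)
    show "rational_fun (tate T) (\<lambda>P. G P * (- 4 * (x_coord P + T) - A))"
      by (intro rational_fun_mult G rat_trace)
    show "eventually (\<lambda>P. y_coord P = - 2 * t * G (isog2 P) +
        (G (isog2 P) * (- 4 * (x_coord (isog2 P) + T) - A)) * x_coord P) (almost_all_points mid)"
      using aff eventually_compose_filterlim[OF D_nz lim]
    proof eventually_elim
      case (elim P)
      then obtain x y where P: "P = Affine x y" "x \<noteq> 0" "Affine x y \<in> points mid" by (auto simp: points_def)
      define p where "p = - quarter * y ^ 2 / x ^ 2"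
      define q where "q = k * y * (t - x ^ 2) / x ^ 2"
      define \<sigma> where "\<sigma> = - 4 * p - A"
      define g where "g = G (isog2 P)"
      note iso = isog2_affine[OF P(2) p_def q_def]
      have px: "x_coord (isog2 P) + T = p" and qy: "y_coord (isog2 P) + half * (x_coord (isog2 P) + T) = q"
        unfolding P(1) iso by simp_all
      have DP: "D (isog2 P) = \<sigma> ^ 2 - 4 * t"
        unfolding D_def px \<sigma>_def by simp
      have g: "g * (\<sigma> ^ 2 - 4 * t) = 64 * k * q"
        using elim(2) unfolding DP g_def G_def qy by simp
      have nz: "\<sigma> ^ 2 - 4 * t \<noteq> 0"
        using elim(2) unfolding DP .
      have q: "q * x ^ 2 = k * y * (t - x ^ 2)"
        using P(2) by (simp add: q_def)
      have x2: "x ^ 2 = \<sigma> * x - t"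
        using quadratic[OF P(3,2)] unfolding P(1)[symmetric] px \<sigma>_def .
      have "x ^ 2 * ((\<sigma> ^ 2 - 4 * t) * y) = x ^ 2 * ((\<sigma> ^ 2 - 4 * t) * (g * (\<sigma> * x - 2 * t)))"
        using q g x2 k by Groebner_Basis.algebra
      then have "(\<sigma> ^ 2 - 4 * t) * y = (\<sigma> ^ 2 - 4 * t) * (g * (\<sigma> * x - 2 * t))"
        by (rule mult_left_cancel[THEN iffD1, rotated]) (use P(2) in simp)
      then have "y = g * (\<sigma> * x - 2 * t)"
        by (rule mult_left_cancel[THEN iffD1, rotated]) (use nz in simp)
      then have "y = - 2 * t * g + (g * \<sigma>) * x"
        by (simp add: algebra_simps)
      then show ?case
        unfolding px by (simp add: P(1) g_def \<sigma>_def)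
    qed
  qed
qed

end

subsection \<open>The kernel\<close>

text \<open>The multiples of (0, 0) are listed by explicit addition. The structure \<open>G\<close>
  is left variable between \<open>K\<close> and the whole curve, to cover both the point group and
  its restriction to the kernel.\<close>

lemma generate_tate_point:
  fixes t :: "'k::field" and G :: "'k point monoid"
  defines "E \<equiv> Weierstrass 1 t t 0 0" and "K \<equiv> {Infinity, Affine 0 0, Affine (- t) 0, Affine 0 (- t)}"
  assumes t: "t \<noteq> 0"
    and G: "monoid.mult G = point_add E" "one G = Infinity" "K \<subseteq> carrier G" "carrier G \<subseteq> points E"
  shows "generate G {Affine 0 0} = K"
proof
  have closed: "point_add E P Q \<in> K" if "P \<in> K" "Q \<in> K" for P Q
    using that t by (auto simp: K_def E_def Let_def field_simps power2_eq_square)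
  \<comment> \<open>A chord or tangent sum is \<open>Infinity\<close> only when abscissas agree and
    ordinates are opposite, which determines the inverse of (0, 0).\<close>
  have inv: "inv\<^bsub>G\<^esub> Affine 0 0 = Affine 0 (- t)"
    unfolding m_inv_def
  proof (rule the_equality)
    show "Affine 0 (- t) \<in> carrier G \<and> Affine 0 0 \<otimes>\<^bsub>G\<^esub> Affine 0 (- t) = \<one>\<^bsub>G\<^esub> \<and>
        Affine 0 (- t) \<otimes>\<^bsub>G\<^esub> Affine 0 0 = \<one>\<^bsub>G\<^esub>"
      using G(3) by (auto simp: G(1,2) K_def E_def)
  next
    fix Q assume "Q \<in> carrier G \<and> Affine 0 0 \<otimes>\<^bsub>G\<^esub> Q = \<one>\<^bsub>G\<^esub> \<and> Q \<otimes>\<^bsub>G\<^esub> Affine 0 0 = \<one>\<^bsub>G\<^esub>"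
    then have "point_add E (Affine 0 0) Q = Infinity" by (simp add: G(1,2))
    then show "Q = Affine 0 (- t)"
      by (cases Q) (auto simp: E_def Let_def add_eq_0_iff2 split: if_splits)
  qed
  show "generate G {Affine 0 0} \<subseteq> K"
  proof
    fix P assume "P \<in> generate G {Affine 0 0}"
    then show "P \<in> K"
    proof induction
      case one
      then show ?case by (simp add: G(2) K_def)
    next
      case (incl h)
      then show ?case by (simp add: K_def)
    next
      case (inv h)
      then show ?case using \<open>inv\<^bsub>G\<^esub> Affine 0 0 = Affine 0 (- t)\<close> by (simp add: K_def)
    next
      case (eng h1 h2)
      then show ?case by (simp add: G(1) closed)
    qed
  qed
  show "K \<subseteq> generate G {Affine 0 0}"
  proof -
    have 1: "Affine 0 0 \<in> generate G {Affine 0 0}" by (rule generate.incl) simp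
    have "Affine 0 0 \<otimes>\<^bsub>G\<^esub> Affine 0 0 \<in> generate G {Affine 0 0}"
      by (rule generate.eng[OF 1 1])
    moreover have "Affine 0 0 \<otimes>\<^bsub>G\<^esub> Affine 0 0 = Affine (- t) 0"
      using t by (simp add: G(1) E_def Let_def)
    moreover have "Affine 0 (- t) \<in> generate G {Affine 0 0}"
      using generate.inv[of "Affine 0 0" "{Affine 0 0}" G] by (simp add: inv)
    moreover have "Infinity \<in> generate G {Affine 0 0}"
      using generate.one[of G "{Affine 0 0}"] by (simp add: G(2))
    ultimately show ?thesis using 1 by (simp add: K_def)
  qed
qed

lemma elliptic_curve_tate_iff:
  "elliptic_curve (Weierstrass 1 r r 0 0) \<longleftrightarrow> (r::'k::field) ^ 4 * (1 - 16 * r) \<noteq> 0"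
proof -
  have "discriminant (Weierstrass 1 r r 0 0) = r ^ 4 * (1 - 16 * r)"
    by (simp add: Let_def algebra_simps eval_nat_numeral)
  then show ?thesis by (simp only: elliptic_curve_def)
qed

context tate_pair
begin

lemma kernel_isog:
  "isogeny_kernel (tate t) (tate T) (isog2 \<circ> isog1) = {Infinity, Affine 0 0, Affine (- t) 0, Affine 0 (- t)}"
proof -
  have "isogeny_kernel (tate t) (tate T) (isog2 \<circ> isog1) =
      {P \<in> points (tate t). isog2 (isog1 P) = Infinity}"
    by (simp add: isogeny_kernel_def kernel_def point_group_def)
  also have "\<dots> = {Infinity, Affine 0 0, Affine (- t) 0, Affine 0 (- t)}"
  proof (intro equalityI subsetI)
    fix P assume P: "P \<in> {P \<in> points (tate t). isog2 (isog1 P) = Infinity}"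
    show "P \<in> {Infinity, Affine 0 0, Affine (- t) 0, Affine 0 (- t)}"
    proof (cases P)
      case (Affine x y)
      with P have c: "Affine x y \<in> points (tate t)" by simp
      show ?thesis
      proof (cases "x + t = 0")
        case True
        with tate_kernel_point[OF c] Affine show ?thesis by simp
      next
        case False
        \<comment> \<open>\<open>isog2\<close> sends an affine point to \<open>Infinity\<close>
          exactly when its abscissa vanishes, and the abscissa of the image under
          \<open>isog1\<close> is x^2/(x + t).\<close>
        with P Affine have "x = 0" by (auto split: if_splits)
        moreover from this c have "y * (y + t) = 0" by (simp add: tate_curve_iff)
        ultimately show ?thesis using Affine by (auto simp: add_eq_0_iff2)
      qed
    qed simp
  next
    fix P assume "P \<in> {Infinity, Affine 0 0, Affine (- t) 0, Affine 0 (- t)}"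
    then show "P \<in> {P \<in> points (tate t). isog2 (isog1 P) = Infinity}"
      using t by (auto simp: tate_curve_iff) (simp add: points_def)
  qed
  finally show ?thesis .
qed

lemma isogeny_isog: "isogeny (tate t) (tate T) (isog2 \<circ> isog1)"
  unfolding isogeny_def
proof (intro conjI)
  \<comment> \<open>The discriminants are t^4 (1 - 16t) and T^4 (1 - 16T), so the Fermat relation
    expresses each nonsingularity condition through the other parameter.\<close>
  have "1 - 16 * t = 16 * T" "1 - 16 * T = 16 * t"
    using sum by (simp_all add: algebra_simps)
  then show "elliptic_curve (tate t)" "elliptic_curve (tate T)"
    using t T by (simp_all add: elliptic_curve_tate_iff)
  show "curve_morphism (tate t) (tate T) (isog2 \<circ> isog1)"
    by (rule curve_morphism_compose[OF curve_morphism_isog1 curve_morphism_isog2])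
  show "(isog2 \<circ> isog1) Infinity = Infinity" by simp
  show "\<exists>P\<in>points (tate t). (isog2 \<circ> isog1) P \<noteq> Infinity"
  proof (rule ccontr)
    \<comment> \<open>A constant map would have the whole infinite curve as its kernel, which has
      only four elements.\<close>
    assume "\<not> ?thesis"
    then have "points (tate t) \<subseteq> isogeny_kernel (tate t) (tate T) (isog2 \<circ> isog1)"
      by (auto simp: isogeny_kernel_def kernel_def point_group_def)
    then have "finite (points (tate t))"
      unfolding kernel_isog by (rule finite_subset) simp
    with infinite_points show False by blast
  qed
qed

lemma generate_kernel:
  "generate (point_group (tate t)) {Affine 0 0} = isogeny_kernel (tate t) (tate T) (isog2 \<circ> isog1)"
  unfolding kernel_isog
  by (rule generate_tate_point[OF t]) (auto simp: point_group_def points_def power2_eq_square power3_eq_cube)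

lemma cyclic_isogeny_isog: "cyclic_isogeny (tate t) (tate T) (isog2 \<circ> isog1)"
  unfolding cyclic_isogeny_def
proof (intro conjI isogeny_isog)
  let ?G = "(point_group (tate t))\<lparr>carrier := isogeny_kernel (tate t) (tate T) (isog2 \<circ> isog1)\<rparr>"
  have "generate ?G {Affine 0 0} = carrier ?G"
    unfolding kernel_isog
    by (subst generate_tate_point[OF t]) (auto simp: point_group_def points_def power2_eq_square power3_eq_cube)
  then have "subgroup_generated ?G {Affine 0 0} = ?G"
    by (simp add: subgroup_generated_def kernel_isog)
  then show "cyclic_group ?G"
    unfolding cyclic_group_def by (intro bexI[of _ "Affine 0 0"]) (simp_all add: kernel_isog)
qed

lemma has_degree_isog: "has_degree (tate t) (tate T) (isog2 \<circ> isog1) 4"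
  by (rule has_degree_4_compose_double_covers[OF double_cover_isog1 double_cover_isog2 infinite_points])

end

lemma E1_closure_eq:
  "E1_closure \<alpha> = Weierstrass 1 (to_ac (1 / \<alpha> ^ 4)) (to_ac (1 / \<alpha> ^ 4)) 0 0"
  by (simp add: E1_closure_def E1_def)

theorem theorem6:
  fixes \<alpha> \<beta> :: "'k::field_char_0"
  assumes "(\<alpha>, \<beta>) \<in> Fer4" and "\<alpha> \<noteq> 0" and "\<beta> \<noteq> 0"
  shows "\<exists>\<phi>. cyclic_isogeny (E1_closure \<alpha>) (E1_closure \<beta>) \<phi> \<and>
             has_degree (E1_closure \<alpha>) (E1_closure \<beta>) \<phi> 4 \<and>
             isogeny_kernel (E1_closure \<alpha>) (E1_closure \<beta>) \<phi> =
               generate (point_group (E1_closure \<alpha>)) {Affine 0 0}"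
proof -
  have "16 * (1 / \<alpha> ^ 4) + 16 * (1 / \<beta> ^ 4) = 1"
    using assms by (simp add: Fer4_def field_simps)
  then have "to_ac (16 * (1 / \<alpha> ^ 4) + 16 * (1 / \<beta> ^ 4)) = 1"
    by simp
  then have sum: "16 * to_ac (1 / \<alpha> ^ 4) + 16 * to_ac (1 / \<beta> ^ 4) = 1"
    by (simp only: to_ac_add to_ac_mult to_ac_numeral)
  \<comment> \<open>The step that calls for the algebraic closure: \<open>k\<close> is a square root
    of -1 divided by 8.\<close>
  obtain k :: "'k alg_closure" where "k ^ 2 = - 1 / 64"
    using nth_root_exists[of 2 "- 1 / 64"] by auto
  then have k: "64 * k ^ 2 = - 1" by simp
  interpret tate_pair "to_ac (1 / \<alpha> ^ 4)" "to_ac (1 / \<beta> ^ 4)" k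
    by unfold_locales (use assms sum k in simp_all)
  show ?thesis
    unfolding E1_closure_eq
    using cyclic_isogeny_isog has_degree_isog generate_kernel by metis
qed

end
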